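(* Let $k$ be a field, $R=k[x_1,\ldots,x_d]$ with $d\ge 2$, $\mathfrak{m}=(x_1,\ldots,x_d)$, and let $I=(f_1,\ldots,f_{d+1})$ be an ideal of finite colength, minimally generated by $d+1$ forms of degree $n$. Suppose $J=(f_1,\ldots,f_d)$ is a minimal reduction of $I$, and set $a=f_{d+1}$. Let $\epsilon$ be the socle degree of $R/(J:a)$, that is, the largest integer $m$ such that $(R/(J:a))_m\neq 0$, and put $r=\epsilon+1$. Then $$L=(L_1):_S\mathfrak{m}^r .$$ More precisely, for every $i$, if a form $\mathbf{f}\in L_i$ has all its coefficients in $\mathfrak{m}^r$, then $\mathbf{f}\in (L_1)$.
   Context: $J$ is a reduction of $I$ if $J\subset I$ and $I^{q+1}=JI^q$ for some natural number $q$. Let $S=R[T_1,\ldots,T_{d+1}]$, graded by degree in the $T_j$'s with $S_0=R$, and let $L=\ker(S\to R[It])$, $T_j\mapsto f_jt$, where $R[It]$ is the Rees algebra of $I$. $L_i$ denotes the $R$-module of forms of $L$ of degree $i$ in the $T_j$'s, and $(L_1)$ is the ideal of $S$ generated by $L_1$ (i.e. by the linear forms $\sum_j c_jT_j$ with $\sum_j c_jf_j=0$). The coefficients of a form in $S_i$ are its coefficients in $R$ with respect to the monomials in the $T_j$'s. *)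

theory Defs
  imports
    "HOL-Library.Poly_Mapping"
    "HOL-Library.Cardinality"
    "HOL-Computational_Algebra.Polynomial"
begin

text \<open>Ideals of a commutative ring are its submodules, taken over from the library's
  theory of modules: \<open>is_ideal\<close> is \<open>module.subspace\<close> and \<open>ideal_gen\<close> is \<open>module.span\<close> for the
  ring acting on itself by multiplication.\<close>

global_interpretation ideal: module "(*) :: 'a::comm_ring_1 \<Rightarrow> 'a \<Rightarrow> 'a"
  defines is_ideal = ideal.subspace
    and ideal_gen = ideal.span
  by unfold_locales (auto simp: algebra_simps)

definition ideal_mult :: "'a::comm_ring_1 set \<Rightarrow> 'a set \<Rightarrow> 'a set" where
  "ideal_mult I J = ideal_gen {a * b | a b. a \<in> I \<and> b \<in> J}"

primrec ideal_pow :: "'a::comm_ring_1 set \<Rightarrow> nat \<Rightarrow> 'a set" where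
  "ideal_pow I 0 = UNIV"
| "ideal_pow I (Suc n) = ideal_mult I (ideal_pow I n)"

definition colon :: "'a::comm_ring_1 set \<Rightarrow> 'a set \<Rightarrow> 'a set" where
  "colon A B = {s. \<forall>b\<in>B. s * b \<in> A}"

text \<open>The submodules of \<open>R/I\<close> correspond to the ideals containing \<open>I\<close>, so \<open>R/I\<close> has finite
  length iff the chains of such ideals have bounded length.\<close>

definition finite_colength :: "'a::comm_ring_1 set \<Rightarrow> bool" where
  "finite_colength I \<longleftrightarrow>
    (\<exists>N. \<forall>C. (\<forall>K\<in>C. is_ideal K \<and> I \<subseteq> K) \<and> (\<forall>K\<in>C. \<forall>K'\<in>C. K \<subseteq> K' \<or> K' \<subseteq> K)
        \<longrightarrow> finite C \<and> card C \<le> N + 1)"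

definition minimally_generates :: "('i \<Rightarrow> 'a::comm_ring_1) \<Rightarrow> 'a set \<Rightarrow> bool" where
  "minimally_generates f I \<longleftrightarrow>
    ideal_gen (range f) = I \<and> (\<forall>A. A \<subset> UNIV \<longrightarrow> ideal_gen (f ` A) \<noteq> I)"

definition is_reduction :: "'a::comm_ring_1 set \<Rightarrow> 'a set \<Rightarrow> bool" where
  "is_reduction J I \<longleftrightarrow>
    is_ideal J \<and> J \<subseteq> I \<and> (\<exists>q. ideal_pow I (q + 1) = ideal_mult J (ideal_pow I q))"

definition is_minimal_reduction :: "'a::comm_ring_1 set \<Rightarrow> 'a set \<Rightarrow> bool" where
  "is_minimal_reduction J I \<longleftrightarrow>
    is_reduction J I \<and> (\<forall>J'. is_reduction J' I \<and> J' \<subseteq> J \<longrightarrow> J' = J)"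

text \<open>Polynomials over \<open>'a\<close> in the variables indexed by \<open>'v\<close>, as finitely supported functions
  from exponent vectors to coefficients, with the convolution product of \<open>Poly_Mapping\<close>.
  With \<open>d = CARD('d)\<close>, the ring \<open>k[x\<^sub>1,\<dots>,x\<^sub>d]\<close> is \<open>('d, 'k) mpoly\<close>; the \<open>d + 1\<close> generators
  and the variables \<open>T\<^sub>j\<close> are indexed by \<open>'d option\<close>, where \<open>None\<close> stands for the index \<open>d + 1\<close>.\<close>

type_synonym ('v, 'a) mpoly = "('v \<Rightarrow>\<^sub>0 nat) \<Rightarrow>\<^sub>0 'a"

definition mdegree :: "('v::finite \<Rightarrow>\<^sub>0 nat) \<Rightarrow> nat" where
  "mdegree \<mu> = (\<Sum>v\<in>UNIV. Poly_Mapping.lookup \<mu> v)"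

definition is_form :: "nat \<Rightarrow> ('v::finite, 'a::zero) mpoly \<Rightarrow> bool" where
  "is_form m p \<longleftrightarrow> (\<forall>\<mu>\<in>Poly_Mapping.keys p. mdegree \<mu> = m)"

definition var :: "'v \<Rightarrow> ('v, 'a::comm_ring_1) mpoly" where
  "var v = Poly_Mapping.single (Poly_Mapping.single v 1) 1"

definition mpoly_const :: "'a \<Rightarrow> ('v, 'a::comm_ring_1) mpoly" where
  "mpoly_const c = Poly_Mapping.single 0 c"

definition max_ideal :: "('v, 'a::comm_ring_1) mpoly set" where
  "max_ideal = ideal_gen (range var)"

text \<open>For a homogeneous ideal \<open>K\<close>, the graded piece \<open>(R/K)\<^sub>m\<close> is the image of the forms of
  degree \<open>m\<close>, so it is nonzero iff some form of degree \<open>m\<close> lies outside \<open>K\<close>.\<close>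

definition socle_degree :: "('v::finite, 'a::comm_ring_1) mpoly set \<Rightarrow> nat" where
  "socle_degree K = (GREATEST m. \<exists>p. is_form m p \<and> p \<notin> K)"

text \<open>The \<open>R\<close>-algebra homomorphism \<open>R[T] \<rightarrow> R[It] \<subseteq> R[t]\<close>, \<open>T\<^sub>j \<mapsto> f\<^sub>j t\<close>. It is given with
  codomain \<open>R[t]\<close>, which does not affect its kernel.\<close>

definition rees_map :: "('j::finite \<Rightarrow> 'a::comm_ring_1) \<Rightarrow> ('j, 'a) mpoly \<Rightarrow> 'a poly" where
  "rees_map f F =
    (\<Sum>\<mu>\<in>Poly_Mapping.keys F. smult (Poly_Mapping.lookup F \<mu>) (\<Prod>j\<in>UNIV. monom (f j) 1 ^ Poly_Mapping.lookup \<mu> j))"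

definition rees_kernel :: "('j::finite \<Rightarrow> 'a::comm_ring_1) \<Rightarrow> ('j, 'a) mpoly set" where
  "rees_kernel f = {F. rees_map f F = 0}"

definition rees_kernel_deg :: "('j::finite \<Rightarrow> 'a::comm_ring_1) \<Rightarrow> nat \<Rightarrow> ('j, 'a) mpoly set" where
  "rees_kernel_deg f i = {F \<in> rees_kernel f. is_form i F}"

end

theory Submission imports Defs begin

text \<open>
  Write \<open>g\<^sub>1, \<dots>, g\<^sub>d\<close> for the generators of \<open>J\<close> and \<open>a\<close> for the remaining generator of \<open>I\<close>, and let
  \<open>F \<in> L\<^sub>i\<close> have its coefficients in \<open>\<mm>\<^sup>r\<close>. By the choice of \<open>r\<close>, \<open>\<mm>\<^sup>r \<subseteq> J : a\<close>, so a coefficient \<open>c\<close>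
  of \<open>F\<close> satisfies \<open>c a = \<Sum> b\<^sub>j g\<^sub>j\<close>. All the generators have the same degree, so the \<open>b\<^sub>j\<close> can be
  taken in \<open>\<mm>\<^sup>r\<close> again. The linear form \<open>c T\<^bsub>d+1\<^esub> - \<Sum> b\<^sub>j T\<^sub>j\<close> lies in \<open>L\<^sub>1\<close>, and modulo \<open>(L\<^sub>1)\<close> it
  replaces one factor \<open>T\<^bsub>d+1\<^esub>\<close> without leaving the forms with coefficients in \<open>\<mm>\<^sup>r\<close>
  (\<open>eliminate_None\<close>). Repeating this, \<open>F\<close> is congruent to a form \<open>G\<close> in \<open>T\<^sub>1, \<dots>, T\<^sub>d\<close> that vanishes at
  \<open>g\<close>. Since \<open>J\<close> is of linear type, \<open>G\<close> is a combination of the Koszul relations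
  \<open>g\<^sub>k T\<^sub>j - g\<^sub>j T\<^sub>k \<in> L\<^sub>1\<close>. The equality \<open>L = (L\<^sub>1) : \<mm>\<^sup>r\<close> follows: if \<open>F \<in> L\<close> and \<open>c \<in> \<mm>\<^sup>r\<close>, the
  graded pieces of \<open>c F\<close> are such forms, and conversely \<open>L\<close> is the kernel of a homomorphism whose
  values have no torsion with respect to a power of a variable.

  The substance is that \<open>J\<close> is of linear type. Finite colength and the reduction property put a
  power of \<open>\<mm>\<close> into \<open>J\<close>, so \<open>g\<close> is a system of \<open>d\<close> parameters of \<open>k[x\<^sub>1, \<dots>, x\<^sub>d]\<close>. Three steps lead
  from there to the claim.

  \<^item> The first Koszul homology of \<open>g\<close> vanishes (\<open>syzygies_koszul\<close>). Each \<open>x\<^sub>v\<^sup>N\<close> lies in \<open>J\<close>, hence acts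
    as zero on Koszul homology, and \<open>x\<^sub>1\<^sup>N, \<dots>, x\<^sub>d\<^sup>N\<close> is visibly a regular sequence. Dividing by one of
    these powers at a time trades one homological degree for each, and above degree \<open>d\<close> there are no
    chains at all.

  \<^item> Choose a set \<open>B\<close> of monomials that is a basis of \<open>R/J\<close>. Every element of \<open>R\<close> is uniquely \<open>P(g)\<close>
    for a polynomial \<open>P\<close> with coefficients supported on \<open>B\<close> (\<open>spanning\<close>, \<open>independent\<close>), that is, \<open>R\<close>
    is free over \<open>k[g]\<close>. Existence is graded Nakayama. For uniqueness, the vanishing of Koszul
    homology shows that each \<open>P\<close> with \<open>P(g) = 0\<close> is \<open>\<Sum> T\<^sub>j Q\<^sub>j\<close> with \<open>Q\<^sub>j(g) = 0\<close>, so that \<open>P\<close> has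
    arbitrarily high order.

  \<^item> Modulo the Koszul relations, a term \<open>g\<^sup>\<alpha> T\<^sup>\<mu>\<close> depends only on \<open>\<alpha> + \<mu>\<close> and the degree of \<open>\<mu>\<close>
    (\<open>koszul_ideal_mon\<close>). Expanding the coefficients of a form over \<open>k[g]\<close> and collecting terms, a
    form that vanishes at \<open>g\<close> cancels completely, by uniqueness (\<open>linear_type\<close>).
\<close>

(* With multiplication as scalar action, this rule is associativity to the left and would make
   the simplifier loop together with the associativity rule of the ring. *)
declare ideal.scale_scale [simp del]

abbreviation "keys \<equiv> Poly_Mapping.keys"
abbreviation "lookup \<equiv> Poly_Mapping.lookup"
abbreviation "single \<equiv> Poly_Mapping.single"

section \<open>Polynomials as sums of monomials\<close>

lemma poly_mapping_sum_single: "p = (\<Sum>x\<in>keys p. single x (lookup p x))"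
proof (rule poly_mapping_eqI)
  fix y
  show "lookup p y = lookup (\<Sum>x\<in>keys p. single x (lookup p x)) y"
    by (auto simp: lookup_sum lookup_single when_def sum.delta in_keys_iff)
qed

lemma poly_mapping_sum_induct [case_names single zero add]:
  fixes p :: "'x \<Rightarrow>\<^sub>0 'a::comm_monoid_add"
  assumes single: "\<And>x. x \<in> keys p \<Longrightarrow> P (single x (lookup p x))"
    and zero: "P 0"
    and add: "\<And>q r. P q \<Longrightarrow> P r \<Longrightarrow> P (q + r)"
  shows "P p"
proof -
  have "P (\<Sum>x\<in>A. single x (lookup p x))" if "finite A" "A \<subseteq> keys p" for A
    using that by (induction A rule: finite_induct) (auto intro!: zero add single)
  from this[of "keys p"] show ?thesis
    by (simp flip: poly_mapping_sum_single)
qed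

lemma sum_keys_add:
  fixes \<phi> :: "'x \<Rightarrow> 'a::comm_monoid_add \<Rightarrow> 'b::comm_monoid_add"
  assumes zero: "\<And>x. \<phi> x 0 = 0" and add: "\<And>x a b. \<phi> x (a + b) = \<phi> x a + \<phi> x b"
  shows "(\<Sum>x\<in>keys (p + q). \<phi> x (lookup (p + q) x))
    = (\<Sum>x\<in>keys p. \<phi> x (lookup p x)) + (\<Sum>x\<in>keys q. \<phi> x (lookup q x))"
proof -
  let ?A = "keys p \<union> keys q"
  have ext: "(\<Sum>x\<in>keys r. \<phi> x (lookup r x)) = (\<Sum>x\<in>?A. \<phi> x (lookup r x))"
    if "keys r \<subseteq> ?A" for r
    using that by (intro sum.mono_neutral_left) (auto simp: in_keys_iff zero)
  show ?thesis
    unfolding ext[OF keys_add] ext[OF Un_upper1] ext[OF Un_upper2]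
    by (simp add: lookup_add add sum.distrib)
qed

definition mon :: "('j::finite \<Rightarrow> 'b::comm_ring_1) \<Rightarrow> ('j \<Rightarrow>\<^sub>0 nat) \<Rightarrow> 'b" where
  "mon u \<mu> = (\<Prod>j\<in>UNIV. u j ^ lookup \<mu> j)"

text \<open>The extension of \<open>\<phi>\<close> with \<open>T\<^sub>j \<mapsto> u\<^sub>j\<close>. Evaluation at \<open>f\<close>, the map onto the Rees algebra and the
  inclusion of one polynomial ring into a larger one all have this form.\<close>

definition eval_mpoly ::
    "('a::comm_ring_1 \<Rightarrow> 'b::comm_ring_1) \<Rightarrow> ('j::finite \<Rightarrow> 'b) \<Rightarrow> ('j, 'a) mpoly \<Rightarrow> 'b" where
  "eval_mpoly \<phi> u F = (\<Sum>\<mu>\<in>keys F. \<phi> (lookup F \<mu>) * mon u \<mu>)"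

lemma mon_zero [simp]: "mon u 0 = 1"
  by (simp add: mon_def)

lemma mon_add: "mon u (\<mu> + \<nu>) = mon u \<mu> * mon u \<nu>"
  by (simp add: mon_def lookup_add power_add prod.distrib)

lemma mon_single: "mon u (single j m) = u j ^ m"
proof -
  have "mon u (single j m) = (\<Prod>i\<in>UNIV. if i = j then u j ^ m else 1)"
    unfolding mon_def by (intro prod.cong) (auto simp: lookup_single when_def)
  then show ?thesis by simp
qed

locale ring_hom_fun =
  fixes \<phi> :: "'a::comm_ring_1 \<Rightarrow> 'b::comm_ring_1"
  assumes hom_add: "\<phi> (a + b) = \<phi> a + \<phi> b"
    and hom_mult: "\<phi> (a * b) = \<phi> a * \<phi> b"
    and hom_one: "\<phi> 1 = 1"
begin

lemma hom_zero: "\<phi> 0 = 0"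
  using hom_add[of 0 0] by simp

lemma eval_single: "eval_mpoly \<phi> u (single \<mu> c) = \<phi> c * mon u \<mu>"
  by (cases "c = 0") (simp_all add: eval_mpoly_def mon_def hom_zero)

lemma eval_zero: "eval_mpoly \<phi> u 0 = 0"
  by (simp add: eval_mpoly_def)

lemma eval_add: "eval_mpoly \<phi> u (F + G) = eval_mpoly \<phi> u F + eval_mpoly \<phi> u G"
  unfolding eval_mpoly_def
  by (rule sum_keys_add) (simp_all add: hom_zero hom_add distrib_right)

lemma eval_diff: "eval_mpoly \<phi> u (F - G) = eval_mpoly \<phi> u F - eval_mpoly \<phi> u G"
  using eval_add[of u "F - G" G] by (simp add: algebra_simps)

lemma eval_sum: "eval_mpoly \<phi> u (\<Sum>x\<in>A. g x) = (\<Sum>x\<in>A. eval_mpoly \<phi> u (g x))"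
  by (induction A rule: infinite_finite_induct) (simp_all add: eval_zero eval_add)

lemma eval_mult: "eval_mpoly \<phi> u (F * G) = eval_mpoly \<phi> u F * eval_mpoly \<phi> u G"
proof (induction F rule: poly_mapping_sum_induct)
  case (single \<mu>)
  have "eval_mpoly \<phi> u (single \<mu> b * G) = eval_mpoly \<phi> u (single \<mu> b) * eval_mpoly \<phi> u G" for b
  proof (induction G rule: poly_mapping_sum_induct)
    case (single \<nu>)
    show ?case by (simp only: mult_single eval_single hom_mult mon_add mult_ac)
  qed (simp_all add: eval_zero eval_add distrib_left)
  then show ?case .
qed (simp_all add: eval_zero eval_add distrib_right)

lemma hom_power: "\<phi> (x ^ m) = \<phi> x ^ m"
  by (induction m) (simp_all add: hom_one hom_mult)

lemma hom_mon: "\<phi> (mon u \<mu>) = mon (\<lambda>j. \<phi> (u j)) \<mu>"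
proof -
  have "\<phi> (\<Prod>j\<in>A. u j ^ lookup \<mu> j) = (\<Prod>j\<in>A. \<phi> (u j) ^ lookup \<mu> j)" for A
    by (induction A rule: infinite_finite_induct) (simp_all add: hom_one hom_mult hom_power)
  then show ?thesis by (simp add: mon_def)
qed

lemma is_ideal_vimage:
  assumes "is_ideal K"
  shows "is_ideal {x. \<phi> x \<in> K}"
  by (rule ideal.subspaceI)
    (simp_all add: hom_zero hom_add hom_mult ideal.subspace_0[OF assms] ideal.subspace_add[OF assms]
      ideal.subspace_scale[OF assms])

lemma ring_hom_eval: "ring_hom_fun (eval_mpoly \<phi> u)"
proof
  show "eval_mpoly \<phi> u 1 = 1"
    using eval_single[of u 0 1] by (simp add: hom_one)
qed (simp_all add: eval_add eval_mult)

end

interpretation id_hom: ring_hom_fun "\<lambda>c::'a::comm_ring_1. c"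
  by unfold_locales auto

interpretation const_hom: ring_hom_fun "mpoly_const :: 'a::comm_ring_1 \<Rightarrow> ('v, 'a) mpoly"
  by unfold_locales (simp_all add: mpoly_const_def single_add mult_single)

interpretation poly_const_hom: ring_hom_fun "\<lambda>c::'a::comm_ring_1. [:c:]"
  by unfold_locales (simp_all add: one_pCons)

lemma mpoly_const_times_single: "mpoly_const c * single \<mu> b = single \<mu> (c * b)"
  by (simp add: mpoly_const_def mult_single)

lemma lookup_mpoly_const_times: "lookup (mpoly_const c * F) \<mu> = c * lookup F \<mu>"
  by (induction F rule: poly_mapping_sum_induct)
    (simp_all add: mpoly_const_times_single lookup_single when_def lookup_add algebra_simps)

section \<open>Degrees\<close>

lemma mdegree_add: "mdegree (\<mu> + \<nu>) = mdegree \<mu> + mdegree \<nu>"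
  by (simp add: mdegree_def lookup_add sum.distrib)

lemma mdegree_zero [simp]: "mdegree 0 = 0"
  by (simp add: mdegree_def)

lemma mdegree_single [simp]: "mdegree (single v m) = m"
  by (simp add: mdegree_def lookup_single when_def)

lemma lookup_le_mdegree: "lookup \<mu> v \<le> mdegree \<mu>"
  unfolding mdegree_def by (rule member_le_sum) auto

lemma exponent_split_var:
  assumes "lookup \<mu> v > 0"
  obtains \<nu> where "\<mu> = \<nu> + single v (1::nat)"
proof
  show "\<mu> = (\<mu> - single v 1) + single v 1"
    using assms by (intro poly_mapping_eqI) (auto simp: lookup_add lookup_minus lookup_single when_def)
qed

lemma mdegree_pos_obtain:
  assumes "mdegree \<mu> > 0"
  obtains v where "lookup \<mu> v > 0"
  using assms unfolding mdegree_def by (metis not_gr_zero sum.neutral)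

lemma mdegree_split:
  assumes "m \<le> mdegree \<mu>"
  obtains \<nu> \<rho> where "\<mu> = \<nu> + \<rho>" "mdegree \<nu> = m"
  using assms
proof (induction m arbitrary: thesis)
  case 0
  show ?case by (rule "0.prems"(1)[of 0 \<mu>]) auto
next
  case (Suc m)
  obtain \<nu> \<rho> where *: "\<mu> = \<nu> + \<rho>" "mdegree \<nu> = m"
    using Suc.IH Suc.prems(2) by auto
  then have "mdegree \<rho> > 0" using Suc.prems(2) by (simp add: mdegree_add)
  then obtain v where "lookup \<rho> v > 0" by (rule mdegree_pos_obtain)
  then obtain \<rho>' where "\<rho> = \<rho>' + single v 1" by (rule exponent_split_var)
  with * show ?case by (intro Suc.prems(1)[of "\<nu> + single v 1" \<rho>']) (auto simp: mdegree_add ac_simps)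
qed

definition deg_part :: "(nat \<Rightarrow> bool) \<Rightarrow> ('v::finite, 'a::zero) mpoly \<Rightarrow> ('v, 'a) mpoly" where
  "deg_part Q p = Poly_Mapping.mapp (\<lambda>\<mu> c. if Q (mdegree \<mu>) then c else 0) p"

lemma lookup_deg_part: "lookup (deg_part Q p) \<mu> = (if Q (mdegree \<mu>) then lookup p \<mu> else 0)"
  by (auto simp: deg_part_def lookup_mapp when_def in_keys_iff)

lemma keys_deg_part: "keys (deg_part Q p) = {\<mu> \<in> keys p. Q (mdegree \<mu>)}"
  by (auto simp: in_keys_iff lookup_deg_part split: if_splits)

lemma deg_part_zero [simp]: "deg_part Q 0 = 0"
  by (intro poly_mapping_eqI) (simp add: lookup_deg_part)

lemma deg_part_add: "deg_part Q (p + q) = deg_part Q p + deg_part Q (q :: ('v::finite, 'a::monoid_add) mpoly)"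
  by (intro poly_mapping_eqI) (simp add: lookup_deg_part lookup_add)

lemma deg_part_diff: "deg_part Q (p - q) = deg_part Q p - deg_part Q (q :: ('v::finite, 'a::cancel_comm_monoid_add) mpoly)"
  by (intro poly_mapping_eqI) (simp add: lookup_deg_part lookup_minus)

lemma deg_part_sum: "deg_part Q (\<Sum>x\<in>A. g x :: ('v::finite, 'a::comm_monoid_add) mpoly) = (\<Sum>x\<in>A. deg_part Q (g x))"
  by (induction A rule: infinite_finite_induct) (simp_all add: deg_part_add)

lemma deg_part_single: "deg_part Q (single \<mu> c) = (if Q (mdegree \<mu>) then single \<mu> c else 0)"
  by (intro poly_mapping_eqI) (simp add: lookup_deg_part lookup_single when_def)

lemma deg_part_eq_self: "(\<And>\<mu>. \<mu> \<in> keys p \<Longrightarrow> Q (mdegree \<mu>)) \<Longrightarrow> deg_part Q p = p"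
  by (intro poly_mapping_eqI) (auto simp: lookup_deg_part in_keys_iff)

text \<open>Used to cut an equation between combinations of forms of degree \<open>n\<close> down to the degrees of
  interest: the coefficients are cut down in the degrees shifted by \<open>n\<close>.\<close>

lemma deg_part_mult_form:
  fixes f g :: "('v::finite, 'a::comm_ring_1) mpoly"
  assumes "is_form n f"
  shows "deg_part Q (g * f) = deg_part (\<lambda>m. Q (m + n)) g * f"
proof (induction g rule: poly_mapping_sum_induct)
  case (single \<mu>)
  have n: "mdegree \<nu> = n" if "\<nu> \<in> keys f" for \<nu>
    using assms that by (auto simp: is_form_def)
  have "deg_part Q (single \<mu> b * f) = deg_part (\<lambda>m. Q (m + n)) (single \<mu> b) * f" for b
    by (induction f rule: poly_mapping_sum_induct)
      (simp_all add: mult_single deg_part_single mdegree_add n deg_part_add distrib_left)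
  then show ?case .
qed (simp_all add: deg_part_add distrib_right)

lemma is_form_zero: "is_form i 0"
  by (simp add: is_form_def)

lemma is_form_single: "mdegree \<mu> = i \<Longrightarrow> is_form i (single \<mu> c)"
  by (simp add: is_form_def)

lemma is_form_add: "is_form i p \<Longrightarrow> is_form i q \<Longrightarrow> is_form i (p + q)"
  unfolding is_form_def using keys_add[of p q] by auto

lemma is_form_diff: "is_form i p \<Longrightarrow> is_form i q \<Longrightarrow> is_form i (p - q :: ('v::finite, 'a::ab_group_add) mpoly)"
  unfolding is_form_def using keys_diff[of p q] by auto

lemma is_form_sum: "(\<And>x. x \<in> A \<Longrightarrow> is_form i (g x)) \<Longrightarrow> is_form i (\<Sum>x\<in>A. g x)"
  by (induction A rule: infinite_finite_induct) (simp_all add: is_form_zero is_form_add)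

lemma is_form_deg_part: "is_form m (deg_part (\<lambda>k. k = m) p)"
  by (simp add: is_form_def keys_deg_part)

lemma is_form_deg_part_shift: "is_form (m - n) (deg_part (\<lambda>k. k + n = m) p)"
  by (auto simp: is_form_def keys_deg_part)

lemma deg_part_form: "is_form m p \<Longrightarrow> deg_part (\<lambda>k. k = m) p = p"
  by (rule deg_part_eq_self) (simp add: is_form_def)

lemma sum_deg_parts:
  fixes p :: "('v::finite, 'a::comm_monoid_add) mpoly"
  shows "p = (\<Sum>m\<in>mdegree ` keys p. deg_part (\<lambda>k. k = m) p)"
  by (intro poly_mapping_eqI) (auto simp: lookup_sum lookup_deg_part sum.delta in_keys_iff)

text \<open>Membership in the \<open>r\<close>-th power of the ideal of the variables (\<open>ideal_pow_max_ideal\<close>), in a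
  form that can be read off from the exponents.\<close>

definition has_order :: "nat \<Rightarrow> ('v::finite, 'a::zero) mpoly \<Rightarrow> bool" where
  "has_order r p \<longleftrightarrow> (\<forall>\<mu>\<in>keys p. r \<le> mdegree \<mu>)"

lemma has_order_zero [simp]: "has_order r 0"
  by (simp add: has_order_def)

lemma has_order_add: "has_order r p \<Longrightarrow> has_order r q \<Longrightarrow> has_order r (p + q :: ('v::finite, 'a::monoid_add) mpoly)"
  unfolding has_order_def using keys_add[of p q] by blast

lemma has_order_sum: "(\<And>x. x \<in> A \<Longrightarrow> has_order r (g x)) \<Longrightarrow> has_order r (\<Sum>x\<in>A. g x :: ('v::finite, 'a::comm_monoid_add) mpoly)"
  by (induction A rule: infinite_finite_induct) (simp_all add: has_order_add)

lemma has_order_mult: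
  fixes p q :: "('v::finite, 'a::comm_ring_1) mpoly"
  assumes "has_order r p" "has_order s q"
  shows "has_order (r + s) (p * q)"
  unfolding has_order_def
proof
  fix \<mu> assume "\<mu> \<in> keys (p * q)"
  then obtain a b where "\<mu> = a + b" "a \<in> keys p" "b \<in> keys q"
    using keys_mult[of p q] by blast
  then show "r + s \<le> mdegree \<mu>"
    using assms by (auto simp: has_order_def mdegree_add intro: add_mono)
qed

lemma has_order_var: "has_order 1 (var v)"
  by (simp add: has_order_def var_def)

lemma ideal_pow_is_ideal: "is_ideal (ideal_pow I r)"
  by (cases r) (simp_all add: ideal_mult_def)

lemma ideal_mult_mem: "a \<in> I \<Longrightarrow> b \<in> K \<Longrightarrow> a * b \<in> ideal_mult I K"
  unfolding ideal_mult_def by (rule ideal.span_base) blast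

lemma ideal_mult_subset:
  assumes "is_ideal T" "\<And>a b. a \<in> I \<Longrightarrow> b \<in> K \<Longrightarrow> a * b \<in> T"
  shows "ideal_mult I K \<subseteq> T"
  unfolding ideal_mult_def using assms by (intro ideal.span_minimal) auto

text \<open>A monomial of degree at least \<open>m s\<close> is a multiple of a product of \<open>s\<close> monomials of degree \<open>m\<close>.\<close>

lemma has_order_imp_ideal_pow:
  fixes p :: "('v::finite, 'a::comm_ring_1) mpoly"
  assumes I: "\<And>\<mu>. mdegree \<mu> = m \<Longrightarrow> single \<mu> 1 \<in> I" and p: "has_order (m * s) p"
  shows "p \<in> ideal_pow I s"
proof -
  have mon: "single \<mu> c \<in> ideal_pow I s" if "m * s \<le> mdegree \<mu>" for \<mu> and c :: 'a
    using that
  proof (induction s arbitrary: \<mu>)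
    case (Suc s)
    then obtain \<nu> \<rho> where *: "\<mu> = \<nu> + \<rho>" "mdegree \<nu> = m"
      using mdegree_split[of m \<mu>] by auto
    with Suc have "single \<rho> c \<in> ideal_pow I s" by (simp add: mdegree_add)
    then have "single \<nu> 1 * single \<rho> c \<in> ideal_pow I (Suc s)"
      using I * by (auto intro: ideal_mult_mem)
    then show ?case by (simp add: mult_single *)
  qed simp
  show ?thesis
  proof (induction p rule: poly_mapping_sum_induct)
    case (single \<mu>)
    then show ?case using p by (intro mon) (auto simp: has_order_def)
  next
    case zero
    show ?case by (rule ideal.subspace_0[OF ideal_pow_is_ideal])
  next
    case (add q r)
    then show ?case by (rule ideal.subspace_add[OF ideal_pow_is_ideal])
  qed
qed

lemma is_ideal_has_order: "is_ideal {p :: ('v::finite, 'a::comm_ring_1) mpoly. has_order r p}"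
proof (rule ideal.subspaceI)
  fix c p :: "('v, 'a) mpoly"
  assume "p \<in> {p. has_order r p}"
  then show "c * p \<in> {p. has_order r p}"
    using has_order_mult[of 0 c r p] by (simp add: has_order_def)
qed (auto intro: has_order_add)

lemma ideal_pow_max_ideal:
  "p \<in> ideal_pow max_ideal r \<longleftrightarrow> has_order r (p :: ('v::finite, 'a::comm_ring_1) mpoly)"
proof
  have 1: "(max_ideal :: ('v, 'a) mpoly set) \<subseteq> {p. has_order 1 p}"
    unfolding max_ideal_def
    by (rule ideal.span_minimal) (use has_order_var in \<open>auto intro: is_ideal_has_order simp del: One_nat_def\<close>)
  show "has_order r p" if "p \<in> ideal_pow max_ideal r"
    using that
  proof (induction r arbitrary: p)
    case (Suc r)
    have "ideal_mult max_ideal (ideal_pow max_ideal r) \<subseteq> {p :: ('v, 'a) mpoly. has_order (Suc r) p}"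
    proof (rule ideal_mult_subset[OF is_ideal_has_order])
      fix a b :: "('v, 'a) mpoly" assume "a \<in> max_ideal" "b \<in> ideal_pow max_ideal r"
      then have "has_order (1 + r) (a * b)" using 1 Suc.IH by (intro has_order_mult) auto
      then show "a * b \<in> {p. has_order (Suc r) p}" by simp
    qed
    then show ?case using Suc.prems by auto
  qed (simp add: has_order_def)
next
  assume "has_order r p"
  moreover have "single \<mu> 1 \<in> (max_ideal :: ('v, 'a) mpoly set)" if \<mu>: "mdegree \<mu> = 1" for \<mu>
  proof -
    obtain v where "lookup \<mu> v > 0" using mdegree_pos_obtain[of \<mu>] \<mu> by auto
    then obtain \<nu> where \<nu>: "\<mu> = \<nu> + single v 1" by (rule exponent_split_var)
    have "single \<nu> 1 * var v \<in> (max_ideal :: ('v, 'a) mpoly set)"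
      unfolding max_ideal_def by (intro ideal.span_scale ideal.span_base) auto
    then show ?thesis by (simp add: \<nu> var_def mult_single)
  qed
  ultimately show "p \<in> ideal_pow max_ideal r"
    by (intro has_order_imp_ideal_pow[of 1]) auto
qed

lemma ideal_gen_range:
  fixes g :: "'j::finite \<Rightarrow> 'a::comm_ring_1"
  shows "ideal_gen (range g) = {\<Sum>j\<in>UNIV. c j * g j |c. True}" (is "_ = ?S")
proof
  have "is_ideal ?S"
  proof (rule ideal.subspaceI)
    show "0 \<in> ?S" by (auto intro!: exI[of _ "\<lambda>_. 0"])
  next
    fix x y assume "x \<in> ?S" "y \<in> ?S"
    then obtain b c where "x = (\<Sum>j\<in>UNIV. b j * g j)" "y = (\<Sum>j\<in>UNIV. c j * g j)" by auto
    then have "x + y = (\<Sum>j\<in>UNIV. (b j + c j) * g j)" by (simp add: distrib_right sum.distrib)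
    then show "x + y \<in> ?S" by (intro CollectI exI conjI TrueI)
  next
    fix a x assume "x \<in> ?S"
    then obtain b where "x = (\<Sum>j\<in>UNIV. b j * g j)" by auto
    then have "a * x = (\<Sum>j\<in>UNIV. (a * b j) * g j)" by (simp only: sum_distrib_left mult.assoc)
    then show "a * x \<in> ?S" by (intro CollectI exI conjI TrueI)
  qed
  moreover have "g j \<in> ?S" for j
  proof -
    have "g j = (\<Sum>i\<in>UNIV. (if i = j then 1 else 0) * g i)"
      by (simp add: if_distrib[of "\<lambda>x. x * _"] cong: if_cong)
    then show ?thesis by (intro CollectI exI conjI TrueI)
  qed
  ultimately show "ideal_gen (range g) \<subseteq> ?S" by (intro ideal.span_minimal) auto
next
  show "?S \<subseteq> ideal_gen (range g)"
    by (auto intro!: ideal.span_sum ideal.span_scale intro: ideal.span_base)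
qed

lemma deg_part_ideal_gen_forms:
  fixes g :: "'j::finite \<Rightarrow> ('v::finite, 'a::comm_ring_1) mpoly"
  assumes "\<And>j. is_form n (g j)" "p \<in> ideal_gen (range g)"
  shows "deg_part Q p \<in> ideal_gen (range g)"
proof -
  obtain c where "p = (\<Sum>j\<in>UNIV. c j * g j)" using assms(2) by (auto simp: ideal_gen_range)
  then have "deg_part Q p = (\<Sum>j\<in>UNIV. deg_part (\<lambda>m. Q (m + n)) (c j) * g j)"
    by (simp add: deg_part_sum deg_part_mult_form[OF assms(1)])
  then show ?thesis
    unfolding ideal_gen_range by (intro CollectI exI conjI TrueI)
qed

section \<open>Koszul acyclicity from a monomial regular sequence\<close>

text \<open>A Koszul chain of degree \<open>j\<close> is encoded by the values of an alternating function on the lists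
  of length \<open>j\<close>. Alternating functions need no ordering of the indices, and prefixing an index turns
  the differential and the homotopy below into plain recursions without signs to keep track of. The
  condition on equal neighbours does not follow from antisymmetry in characteristic 2.\<close>

definition alternating :: "('j list \<Rightarrow> 'a::ab_group_add) \<Rightarrow> bool" where
  "alternating c \<longleftrightarrow>
    (\<forall>xs i k ys. c (xs @ i # k # ys) = - c (xs @ k # i # ys)) \<and>
    (\<forall>xs i ys. c (xs @ i # i # ys) = 0)"

lemma alternatingI:
  assumes "\<And>xs i k ys. c (xs @ i # k # ys) = - c (xs @ k # i # ys)"
    and "\<And>xs i ys. c (xs @ i # i # ys) = 0"
  shows "alternating c"
  unfolding alternating_def by (intro conjI allI assms)

lemma alternating_swap: "alternating c \<Longrightarrow> c (xs @ i # k # ys) = - c (xs @ k # i # ys)"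
  unfolding alternating_def by blast

lemma alternating_same: "alternating c \<Longrightarrow> c (xs @ i # i # ys) = 0"
  unfolding alternating_def by blast

lemma alternating_Cons:
  assumes "alternating c"
  shows "alternating (\<lambda>l. c (i # l))"
  by (rule alternatingI)
    (rule alternating_swap[OF assms, of "i # _", simplified] alternating_same[OF assms, of "i # _", simplified])+

lemma alternating_additive:
  assumes "alternating c" "\<And>x. T (- x) = - T x" "T 0 = 0"
  shows "alternating (\<lambda>l. T (c l))"
proof (rule alternatingI)
  show "T (c (xs @ i # k # ys)) = - T (c (xs @ k # i # ys))" for xs i k ys
    by (subst alternating_swap[OF assms(1)]) (rule assms(2))
  show "T (c (xs @ i # i # ys)) = 0" for xs i ys
    by (simp add: alternating_same[OF assms(1)] assms(3))
qed

lemma alternating_diff: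
  assumes "alternating b" "alternating c"
  shows "alternating (\<lambda>l. b l - c l)"
proof (rule alternatingI)
  show "b (xs @ i # k # ys) - c (xs @ i # k # ys) = - (b (xs @ k # i # ys) - c (xs @ k # i # ys))" for xs i k ys
    by (subst alternating_swap[OF assms(1)], subst alternating_swap[OF assms(2)]) simp
  show "b (xs @ i # i # ys) - c (xs @ i # i # ys) = 0" for xs i ys
    by (simp add: alternating_same assms)
qed

lemma alternating_not_distinct:
  assumes "alternating c" "\<not> distinct l"
  shows "c l = 0"
proof -
  have "c (xs @ i # ys @ i # zs) = 0" for xs i ys zs
  proof (induction ys arbitrary: xs)
    case Nil
    show ?case using alternating_same[OF assms(1)] by simp
  next
    case (Cons y ys)
    have "c (xs @ i # y # ys @ i # zs) = - c ((xs @ [y]) @ i # ys @ i # zs)"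
      by (subst alternating_swap[OF assms(1)]) simp
    then show ?case using Cons.IH[of "xs @ [y]"] by simp
  qed
  moreover obtain xs ys zs i where "l = xs @ [i] @ ys @ [i] @ zs"
    using not_distinct_decomp[OF assms(2)] by blast
  ultimately show ?thesis by simp
qed

definition koszul_diff :: "('j::finite \<Rightarrow> 'a::comm_ring_1) \<Rightarrow> ('j list \<Rightarrow> 'a) \<Rightarrow> 'j list \<Rightarrow> 'a" where
  "koszul_diff f c l = (\<Sum>i\<in>UNIV. f i * c (i # l))"

text \<open>The exterior product with \<open>\<Sum> a\<^sub>i e\<^sub>i\<close>, the contracting homotopy for multiplication by
  \<open>\<Sum> a\<^sub>i f\<^sub>i\<close>.\<close>

fun koszul_homotopy :: "('j \<Rightarrow> 'a::comm_ring_1) \<Rightarrow> ('j list \<Rightarrow> 'a) \<Rightarrow> 'j list \<Rightarrow> 'a" where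
  "koszul_homotopy a c [] = 0"
| "koszul_homotopy a c (i # l) = a i * c l - koszul_homotopy a (\<lambda>m. c (i # m)) l"

lemma alternating_koszul_diff:
  assumes "alternating c"
  shows "alternating (koszul_diff f c)"
proof (rule alternatingI)
  fix xs i k ys
  have "c (x # xs @ i # k # ys) = - c (x # xs @ k # i # ys)" for x
    by (rule alternating_swap[OF assms, of "x # xs", simplified])
  then show "koszul_diff f c (xs @ i # k # ys) = - koszul_diff f c (xs @ k # i # ys)"
    unfolding koszul_diff_def sum_negf[symmetric] by (intro sum.cong) (simp_all only: mult_minus_right)
next
  fix xs i ys
  have "c (x # xs @ i # i # ys) = 0" for x
    by (rule alternating_same[OF assms, of "x # xs", simplified])
  then show "koszul_diff f c (xs @ i # i # ys) = 0"
    by (simp add: koszul_diff_def)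
qed

lemma koszul_homotopy_sum:
  "koszul_homotopy a (\<lambda>m. \<Sum>x\<in>X. b x * c x m) l = (\<Sum>x\<in>X. b x * koszul_homotopy a (c x) l)"
proof (induction l arbitrary: c)
  case (Cons i l)
  have "a i * (\<Sum>x\<in>X. b x * c x l) = (\<Sum>x\<in>X. b x * (a i * c x l))"
    by (simp only: sum_distrib_left mult.left_commute)
  then show ?case
    by (simp only: koszul_homotopy.simps Cons.IH right_diff_distrib sum_subtractf)
qed simp

lemma koszul_homotopy_minus:
  "koszul_homotopy a (\<lambda>m. - c m) l = - koszul_homotopy a c l"
  by (induction l arbitrary: c) simp_all

lemma koszul_homotopy_zero: "koszul_homotopy a (\<lambda>m. 0) l = 0"
  by (induction l) simp_all

text \<open>The equation \<open>D h + h D = z\<close> with \<open>z = \<Sum> a\<^sub>i f\<^sub>i\<close>: every element of the ideal of the \<open>f\<^sub>i\<close> is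
  homotopic to zero.\<close>

lemma koszul_homotopy_identity:
  "koszul_diff f (koszul_homotopy a c) l
    = (\<Sum>i\<in>UNIV. a i * f i) * c l - koszul_homotopy a (koszul_diff f c) l"
proof -
  have "koszul_diff f (koszul_homotopy a c) l
    = (\<Sum>i\<in>UNIV. a i * f i * c l - f i * koszul_homotopy a (\<lambda>m. c (i # m)) l)"
    unfolding koszul_diff_def by (intro sum.cong) (simp_all add: algebra_simps)
  also have "\<dots> = (\<Sum>i\<in>UNIV. a i * f i) * c l - koszul_homotopy a (koszul_diff f c) l"
    unfolding koszul_diff_def koszul_homotopy_sum by (simp add: sum_subtractf sum_distrib_right)
  finally show ?thesis .
qed

lemma koszul_homotopy_mem:
  assumes "is_ideal Z" "\<And>m. Suc (length m) = length l \<Longrightarrow> c m \<in> Z"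
  shows "koszul_homotopy a c l \<in> Z"
  using assms(2)
proof (induction l arbitrary: c)
  case Nil
  show ?case using assms(1) by (simp add: ideal.subspace_0)
next
  case (Cons i l)
  have "a i * c l \<in> Z" using Cons.prems by (intro ideal.subspace_scale[OF assms(1)]) simp
  moreover have "koszul_homotopy a (\<lambda>m. c (i # m)) l \<in> Z"
    using Cons.prems by (intro Cons.IH) simp
  ultimately show ?case using ideal.subspace_diff[OF assms(1)] by simp
qed

lemma alternating_koszul_homotopy:
  assumes "alternating c"
  shows "alternating (koszul_homotopy a c)"
proof (rule alternatingI)
  fix xs i k ys
  show "koszul_homotopy a c (xs @ i # k # ys) = - koszul_homotopy a c (xs @ k # i # ys)"
    using assms
  proof (induction xs arbitrary: c)
    case Nil
    have "(\<lambda>m. c (i # k # m)) = (\<lambda>m. - c (k # i # m))"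
      by (rule ext, rule alternating_swap[OF Nil, of "[]", simplified])
    then have "koszul_homotopy a (\<lambda>m. c (i # k # m)) ys = - koszul_homotopy a (\<lambda>m. c (k # i # m)) ys"
      by (simp only: koszul_homotopy_minus)
    then show ?case by simp
  next
    case (Cons x xs)
    have "c (xs @ i # k # ys) = - c (xs @ k # i # ys)"
      by (rule alternating_swap[OF Cons.prems])
    moreover have "koszul_homotopy a (\<lambda>m. c (x # m)) (xs @ i # k # ys)
        = - koszul_homotopy a (\<lambda>m. c (x # m)) (xs @ k # i # ys)"
      by (rule Cons.IH[OF alternating_Cons[OF Cons.prems]])
    ultimately show ?case by simp
  qed
next
  fix xs i ys
  show "koszul_homotopy a c (xs @ i # i # ys) = 0"
    using assms
  proof (induction xs arbitrary: c)
    case Nil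
    have "c (i # i # m) = 0" for m
      using alternating_same[OF Nil, of "[]"] by simp
    then show ?case by (simp add: koszul_homotopy_zero)
  next
    case (Cons x xs)
    then show ?case
      using alternating_same[OF Cons.prems] Cons.IH[OF alternating_Cons[OF Cons.prems]] by simp
  qed
qed

text \<open>The strictly upper triangular part of \<open>b\<close> serves as \<open>u\<close>, with respect to an arbitrary
  numbering of the indices. The form \<open>U - U\<^sup>T\<close> is convenient because antisymmetry survives when the
  entries of \<open>U\<close> are replaced by arbitrarily chosen preimages.\<close>

lemma antisymmetric_decomposition:
  fixes b :: "'j::finite \<Rightarrow> 'j \<Rightarrow> 'a::comm_ring_1"
  assumes anti: "\<And>i k. b i k = - b k i" and diag: "\<And>i. b i i = 0"
  shows "\<exists>u. \<forall>i k. b i k = u i k - u k i"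
proof -
  obtain idx :: "'j \<Rightarrow> nat" where idx: "inj idx"
    using finite_imp_inj_to_nat_seg[of "UNIV :: 'j set"] by auto
  define u where "u i k = (if idx i < idx k then b i k else 0)" for i k
  have "b i k = u i k - u k i" for i k
  proof (cases "idx i = idx k")
    case True
    then show ?thesis using idx diag by (simp add: u_def inj_eq)
  next
    case False
    then show ?thesis using anti[of i k] by (auto simp: u_def)
  qed
  then show ?thesis by blast
qed

lemma antisymmetric_sum_zero:
  fixes b :: "'j::finite \<Rightarrow> 'j \<Rightarrow> 'a::comm_ring_1"
  assumes anti: "\<And>i k. b i k = - b k i" and diag: "\<And>i. b i i = 0"
  shows "(\<Sum>i\<in>UNIV. \<Sum>k\<in>UNIV. w i * w k * b i k) = 0"
proof -
  obtain u where u: "\<And>i k. b i k = u i k - u k i"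
    using antisymmetric_decomposition[of b, OF anti diag] by blast
  have "(\<Sum>i\<in>UNIV. \<Sum>k\<in>UNIV. w i * w k * u i k) = (\<Sum>i\<in>UNIV. \<Sum>k\<in>UNIV. w i * w k * u k i)"
    by (subst sum.swap) (simp add: mult.commute)
  then show ?thesis by (simp add: u right_diff_distrib sum_subtractf)
qed

lemma koszul_diff_diff:
  assumes "alternating b"
  shows "koszul_diff f (koszul_diff f b) l = 0"
proof -
  have "koszul_diff f (koszul_diff f b) l = (\<Sum>i\<in>UNIV. \<Sum>k\<in>UNIV. f i * f k * b (k # i # l))"
    by (simp add: koszul_diff_def sum_distrib_left mult.assoc)
  also have "\<dots> = 0"
    by (rule antisymmetric_sum_zero[where b = "\<lambda>i k. b (k # i # l)"])
      (rule alternating_swap[OF assms, of "[]", simplified] alternating_same[OF assms, of "[]", simplified])+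
  finally show ?thesis .
qed

text \<open>The ideal of the powers \<open>x\<^sub>v\<^sup>N\<close> with \<open>v \<in> V\<close>, described by its monomials.\<close>

definition power_ideal :: "nat \<Rightarrow> 'v set \<Rightarrow> ('v, 'a::comm_ring_1) mpoly set" where
  "power_ideal N V = {p. \<forall>\<mu>\<in>keys p. \<exists>v\<in>V. N \<le> lookup \<mu> v}"

lemma is_ideal_power_ideal: "is_ideal (power_ideal N V)"
proof (rule ideal.subspaceI)
  show "0 \<in> power_ideal N V" by (simp add: power_ideal_def)
next
  fix p q :: "('a, 'b) mpoly"
  assume "p \<in> power_ideal N V" "q \<in> power_ideal N V"
  then show "p + q \<in> power_ideal N V"
    using keys_add[of p q] unfolding power_ideal_def by blast
next
  fix c p :: "('a, 'b) mpoly"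
  assume p: "p \<in> power_ideal N V"
  show "c * p \<in> power_ideal N V"
    unfolding power_ideal_def
  proof (intro CollectI ballI)
    fix \<mu> assume "\<mu> \<in> keys (c * p)"
    then obtain \<alpha> \<beta> where "\<mu> = \<alpha> + \<beta>" "\<beta> \<in> keys p" using keys_mult[of c p] by blast
    then show "\<exists>v\<in>V. N \<le> lookup \<mu> v"
      using p by (force simp: power_ideal_def lookup_add intro: trans_le_add2)
  qed
qed

lemma power_ideal_empty: "p \<in> power_ideal N {} \<longleftrightarrow> p = 0"
  by (simp add: power_ideal_def flip: keys_eq_empty)

lemma inj_exponent_shift: "inj (\<lambda>\<mu> :: 'v \<Rightarrow>\<^sub>0 nat. \<mu> + \<nu>)"
  by (simp add: inj_def)

text \<open>Division by a monomial, discarding the remainder. It is additive on all polynomials, so that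
  applied to the values of an alternating function it yields an alternating function.\<close>

definition mon_div :: "('v \<Rightarrow>\<^sub>0 nat) \<Rightarrow> ('v, 'a::comm_ring_1) mpoly \<Rightarrow> ('v, 'a) mpoly" where
  "mon_div \<nu> p = Poly_Mapping.map_key (\<lambda>\<mu>. \<mu> + \<nu>) p"

lemma lookup_mon_div: "lookup (mon_div \<nu> p) \<mu> = lookup p (\<mu> + \<nu>)"
  unfolding mon_div_def by (simp add: map_key.rep_eq inj_exponent_shift)

lemma mon_div_single_mult: "mon_div \<nu> (single \<nu> 1 * p) = p"
proof (induction p rule: poly_mapping_sum_induct)
  case (single \<mu>)
  show ?case
    by (intro poly_mapping_eqI) (auto simp: lookup_mon_div mult_single lookup_single when_def add.commute)
next
  case zero
  show ?case by (intro poly_mapping_eqI) (simp add: lookup_mon_div)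
next
  case (add q r)
  have "mon_div \<nu> (s + t) = mon_div \<nu> s + mon_div \<nu> t" for s t :: "('a, 'b) mpoly"
    by (intro poly_mapping_eqI) (simp add: lookup_mon_div lookup_add)
  then show ?case using add by (simp add: distrib_left)
qed

lemma lookup_single_mult: "lookup (single \<nu> 1 * p) (\<mu> + \<nu>) = lookup (p :: ('v, 'a::comm_ring_1) mpoly) \<mu>"
  by (metis lookup_mon_div mon_div_single_mult)

lemma single_mult_eq_0D: "single \<nu> 1 * p = 0 \<Longrightarrow> p = (0 :: ('v, 'a::comm_ring_1) mpoly)"
  by (metis mon_div_single_mult mult_zero_right)

text \<open>The powers of the variables form a regular sequence, in any order.\<close>

lemma power_ideal_regular:
  assumes "v \<notin> V" "single (single v N) 1 * p \<in> power_ideal N V"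
  shows "p \<in> power_ideal N V"
  unfolding power_ideal_def
proof (intro CollectI ballI)
  fix \<mu> assume "\<mu> \<in> keys p"
  then have "\<mu> + single v N \<in> keys (single (single v N) 1 * p)"
    by (simp add: in_keys_iff lookup_single_mult)
  then obtain w where w: "w \<in> V" "N \<le> lookup (\<mu> + single v N) w"
    using assms(2) by (auto simp: power_ideal_def)
  with assms(1) have "w \<noteq> v" by auto
  with w show "\<exists>v\<in>V. N \<le> lookup \<mu> v" by (auto simp: lookup_add lookup_single)
qed

lemma power_ideal_insert:
  assumes "p \<in> power_ideal N (insert v V)"
  shows "p - single (single v N) 1 * mon_div (single v N) p \<in> power_ideal N V"
  unfolding power_ideal_def
proof (intro CollectI ballI)
  fix \<mu> assume \<mu>: "\<mu> \<in> keys (p - single (single v N) 1 * mon_div (single v N) p)"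
  have "lookup \<mu> v < N"
  proof (rule ccontr)
    assume "\<not> lookup \<mu> v < N"
    then have "\<mu> = (\<mu> - single v N) + single v N"
      by (intro poly_mapping_eqI) (auto simp: lookup_add lookup_minus lookup_single when_def)
    then obtain \<nu> where "\<mu> = \<nu> + single v N" by blast
    then show False using \<mu> by (simp add: in_keys_iff lookup_minus lookup_single_mult lookup_mon_div)
  qed
  moreover have "\<mu> \<in> keys p"
  proof (rule ccontr)
    assume "\<mu> \<notin> keys p"
    then have "\<mu> \<in> keys (single (single v N) 1 * mon_div (single v N) p)"
      using \<mu> by (auto simp: in_keys_iff lookup_minus)
    then obtain \<beta> where "\<mu> = single v N + \<beta>" using keys_mult by (fastforce split: if_splits)
    with \<open>lookup \<mu> v < N\<close> show False by (simp add: lookup_add)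
  qed
  ultimately show "\<exists>v\<in>V. N \<le> lookup \<mu> v"
    using assms by (fastforce simp: power_ideal_def)
qed

text \<open>The vanishing of the Koszul homology of \<open>f\<close> in degree \<open>j + 1\<close> with coefficients in the quotient
  of the polynomial ring by \<open>power_ideal N V\<close>. Lists of length \<open>j\<close> carry the boundaries of chains of
  degree \<open>j + 1\<close>.\<close>

definition koszul_exact :: "('v::finite \<Rightarrow> ('v, 'a::comm_ring_1) mpoly) \<Rightarrow> nat \<Rightarrow> 'v set \<Rightarrow> nat \<Rightarrow> bool" where
  "koszul_exact f N V j \<longleftrightarrow>
    (\<forall>c. alternating c \<longrightarrow> (\<forall>l. length l = j \<longrightarrow> koszul_diff f c l \<in> power_ideal N V) \<longrightarrow>
      (\<exists>b. alternating b \<and> (\<forall>l. length l = Suc j \<longrightarrow> c l - koszul_diff f b l \<in> power_ideal N V)))"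

lemma koszul_exact_top: "koszul_exact (f :: 'v::finite \<Rightarrow> ('v, 'a::comm_ring_1) mpoly) N V CARD('v)"
  unfolding koszul_exact_def
proof (intro allI impI)
  fix c :: "'v list \<Rightarrow> ('v, 'a) mpoly"
  assume c: "alternating c"
  have "c l = 0" if "length l = Suc CARD('v)" for l
  proof (rule alternating_not_distinct[OF c])
    show "\<not> distinct l"
      using that distinct_card[of l] card_mono[of UNIV "set l"] by auto
  qed
  then show "\<exists>b. alternating b \<and> (\<forall>l. length l = Suc CARD('v) \<longrightarrow> c l - koszul_diff f b l \<in> power_ideal N V)"
    by (intro exI[of _ "\<lambda>_. 0"])
      (simp add: alternating_def koszul_diff_def ideal.subspace_0[OF is_ideal_power_ideal])
qed

text \<open>This is the long exact sequence of \<open>z = x\<^sub>v\<^sup>N\<close>, which is regular modulo \<open>power_ideal N V\<close> and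
  annihilates Koszul homology, unwound on chains. If \<open>c\<close> is a cycle modulo \<open>power_ideal N V\<close>, then
  \<open>D h c = z c - h D c\<close> makes \<open>h c\<close> a cycle modulo the larger ideal, one degree higher, hence
  \<open>h c = D b + z e + w\<close>. Applying \<open>D\<close> gives \<open>z (c - D e) \<equiv> 0\<close>, and \<open>z\<close> can be cancelled.\<close>

lemma koszul_exact_step:
  fixes f :: "'v::finite \<Rightarrow> ('v, 'a::comm_ring_1) mpoly"
  assumes exact: "koszul_exact f N (insert v V) (Suc j)" and v: "v \<notin> V"
    and z: "single (single v N) 1 \<in> ideal_gen (range f)"
  shows "koszul_exact f N V j"
  unfolding koszul_exact_def
proof (intro allI impI)
  let ?Z = "power_ideal N V :: ('v, 'a) mpoly set"
  let ?z = "single (single v N) 1 :: ('v, 'a) mpoly"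
  have Z: "is_ideal ?Z" by (rule is_ideal_power_ideal)
  fix c assume c: "alternating c" and cycle: "\<forall>l. length l = j \<longrightarrow> koszul_diff f c l \<in> ?Z"
  obtain a where a: "?z = (\<Sum>i\<in>UNIV. a i * f i)" using z by (auto simp: ideal_gen_range)
  let ?h = "koszul_homotopy a c"
  have hD: "koszul_homotopy a (koszul_diff f c) l \<in> ?Z" if "length l = Suc j" for l
    using cycle that by (intro koszul_homotopy_mem[OF Z]) auto
  have Dh: "koszul_diff f ?h l = ?z * c l - koszul_homotopy a (koszul_diff f c) l" for l
    by (simp add: koszul_homotopy_identity a)
  have mono: "p \<in> power_ideal N (insert v V)" if "p \<in> ?Z" for p
    using that by (auto simp: power_ideal_def)
  have z_mem: "?z * p \<in> power_ideal N (insert v V)" for p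
  proof -
    have "?z \<in> power_ideal N (insert v V)" by (simp add: power_ideal_def)
    from ideal.subspace_scale[OF is_ideal_power_ideal this, of p] show ?thesis by (simp add: mult.commute)
  qed
  have "koszul_diff f ?h l \<in> power_ideal N (insert v V)" if "length l = Suc j" for l
    unfolding Dh using z_mem mono[OF hD[OF that]] by (rule ideal.subspace_diff[OF is_ideal_power_ideal])
  then obtain b where b: "alternating b"
    and hb: "\<And>l. length l = Suc (Suc j) \<Longrightarrow> ?h l - koszul_diff f b l \<in> power_ideal N (insert v V)"
    using exact alternating_koszul_homotopy[OF c, of a] unfolding koszul_exact_def by blast
  define e where "e l = mon_div (single v N) (?h l - koszul_diff f b l)" for l
  have e: "alternating e"
    unfolding e_def
  proof (rule alternating_additive[where T = "mon_div (single v N)"])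
    show "alternating (\<lambda>l. ?h l - koszul_diff f b l)"
      by (rule alternating_diff[OF alternating_koszul_homotopy[OF c] alternating_koszul_diff[OF b]])
  qed (simp_all add: poly_mapping_eq_iff lookup_mon_div fun_eq_iff)
  define w where "w l = ?h l - koszul_diff f b l - ?z * e l" for l
  have w: "w l \<in> ?Z" if "length l = Suc (Suc j)" for l
    unfolding w_def e_def by (rule power_ideal_insert[OF hb[OF that]])
  have "c l - koszul_diff f e l \<in> ?Z" if l: "length l = Suc j" for l
  proof (rule power_ideal_regular[OF v])
    have "koszul_diff f ?h l = koszul_diff f (koszul_diff f b) l + ?z * koszul_diff f e l + koszul_diff f w l"
      by (simp add: koszul_diff_def w_def sum_distrib_left algebra_simps flip: sum.distrib)
    then have "?z * (c l - koszul_diff f e l) = koszul_homotopy a (koszul_diff f c) l + koszul_diff f w l"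
      by (simp add: Dh koszul_diff_diff[OF b] algebra_simps)
    moreover have "koszul_diff f w l \<in> ?Z"
      unfolding koszul_diff_def using l
      by (intro ideal.subspace_sum[OF Z] ideal.subspace_scale[OF Z] w) simp
    ultimately show "?z * (c l - koszul_diff f e l) \<in> ?Z"
      using hD[OF l] by (simp add: ideal.subspace_add[OF Z])
  qed
  with e show "\<exists>b. alternating b \<and> (\<forall>l. length l = Suc j \<longrightarrow> c l - koszul_diff f b l \<in> ?Z)"
    by blast
qed

text \<open>Vanishing is trivial in degrees above \<open>d\<close>, when all \<open>d\<close> powers have been divided out; removing
  them one by one brings it down to degree one and the polynomial ring itself.\<close>

lemma syzygies_koszul:
  fixes f g :: "'v::finite \<Rightarrow> ('v, 'a::comm_ring_1) mpoly"
  assumes z: "\<And>v. single (single v N) 1 \<in> ideal_gen (range f)"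
    and rel: "(\<Sum>j\<in>UNIV. g j * f j) = 0"
  obtains u where "\<And>j. g j = (\<Sum>k\<in>UNIV. (u j k - u k j) * f k)"
proof -
  have exact: "koszul_exact f N V (card V)" for V :: "'v set"
  proof (induction "card (- V)" arbitrary: V)
    case 0
    then have "V = UNIV" by auto
    then show ?case using koszul_exact_top by simp
  next
    case (Suc m)
    then have "- V \<noteq> {}" by (metis card.empty nat.distinct(1))
    then obtain v where v: "v \<notin> V" by blast
    then have "- V = insert v (- insert v V)" by auto
    then have "card (- V) = Suc (card (- insert v V))" by (metis ComplD card_insert_disjoint finite insertI1)
    then have "m = card (- insert v V)" using Suc.hyps(2) by simp
    then have "koszul_exact f N (insert v V) (card (insert v V))" by (rule Suc.hyps(1))
    then show ?case using v by (intro koszul_exact_step[OF _ v z]) simp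
  qed
  define c where "c l = (case l of [i] \<Rightarrow> g i | _ \<Rightarrow> 0)" for l
  have c: "alternating c"
    unfolding alternating_def by (auto simp: c_def Cons_eq_append_conv split: list.split)
  have "koszul_diff f c [] = 0"
    using rel by (simp add: koszul_diff_def c_def mult.commute)
  then obtain b where b: "alternating b" and cb: "\<And>l. length l = 1 \<Longrightarrow> c l - koszul_diff f b l = 0"
    using exact[of "{}"] c unfolding koszul_exact_def by (auto simp: power_ideal_empty)
  have "\<exists>u. \<forall>i k. b [k, i] = u i k - u k i"
  proof (rule antisymmetric_decomposition[where b = "\<lambda>i k. b [k, i]"])
    show "b [k, i] = - b [i, k]" for i k
      by (rule alternating_swap[OF b, of "[]" k i "[]", simplified])
    show "b [i, i] = 0" for i
      by (rule alternating_same[OF b, of "[]" i "[]", simplified])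
  qed
  then obtain u where u: "\<And>i k. b [k, i] = u i k - u k i" by blast
  have "g i = (\<Sum>k\<in>UNIV. (u i k - u k i) * f k)" for i
    using cb[of "[i]"] by (simp add: c_def koszul_diff_def u mult.commute)
  then show ?thesis by (rule that)
qed

section \<open>The polynomial ring is free over the subalgebra of a system of parameters\<close>

lemma finite_exponents_below: "finite {\<mu> :: 'v::finite \<Rightarrow>\<^sub>0 nat. mdegree \<mu> < M}"
proof (rule inj_on_finite)
  show "inj_on lookup {\<mu> :: 'v \<Rightarrow>\<^sub>0 nat. mdegree \<mu> < M}"
    by (auto intro: inj_onI poly_mapping_eqI)
  show "lookup ` {\<mu> :: 'v \<Rightarrow>\<^sub>0 nat. mdegree \<mu> < M} \<subseteq> {h. \<forall>x. (x \<in> UNIV \<longrightarrow> h x \<in> {..<M}) \<and> (x \<notin> UNIV \<longrightarrow> h x = 0)}"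
    using lookup_le_mdegree by (auto intro: le_less_trans)
  show "finite {h :: 'v \<Rightarrow> nat. \<forall>x. (x \<in> UNIV \<longrightarrow> h x \<in> {..<M}) \<and> (x \<notin> UNIV \<longrightarrow> h x = 0)}"
    by (rule finite_set_of_finite_funs) simp_all
qed

text \<open>For a suitable set \<open>B\<close>, evaluation at a system of parameters maps these polynomials
  bijectively onto \<open>R\<close> (\<open>spanning\<close> and \<open>independent\<close> below). Describing the coefficients by their
  monomials makes the condition stable under addition and under passage to homogeneous parts.\<close>

definition coeffs_in :: "('v \<Rightarrow>\<^sub>0 nat) set \<Rightarrow> ('j, ('v, 'k::zero) mpoly) mpoly \<Rightarrow> bool" where
  "coeffs_in B P \<longleftrightarrow> (\<forall>\<alpha>. keys (lookup P \<alpha>) \<subseteq> B)"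

lemma coeffs_in_zero: "coeffs_in B 0"
  by (simp add: coeffs_in_def)

lemma coeffs_in_single: "keys e \<subseteq> B \<Longrightarrow> coeffs_in B (single \<alpha> e)"
  by (simp add: coeffs_in_def lookup_single when_def)

lemma coeffs_in_add: "coeffs_in B P \<Longrightarrow> coeffs_in B Q \<Longrightarrow> coeffs_in B (P + Q)"
  unfolding coeffs_in_def lookup_add by (metis (no_types, lifting) Un_least keys_add order_trans)

lemma coeffs_in_diff:
  fixes P Q :: "('j, ('v, 'k::ab_group_add) mpoly) mpoly"
  shows "coeffs_in B P \<Longrightarrow> coeffs_in B Q \<Longrightarrow> coeffs_in B (P - Q)"
  unfolding coeffs_in_def lookup_minus by (metis (no_types, lifting) Un_least keys_diff order_trans)

lemma coeffs_in_sum: "(\<And>x. x \<in> A \<Longrightarrow> coeffs_in B (P x)) \<Longrightarrow> coeffs_in B (\<Sum>x\<in>A. P x)"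
  by (induction A rule: infinite_finite_induct) (simp_all add: coeffs_in_zero coeffs_in_add)

lemma coeffs_in_var_mult:
  fixes P :: "('j, ('v, 'k::comm_ring_1) mpoly) mpoly"
  assumes "coeffs_in B P"
  shows "coeffs_in B (var j * P)"
  unfolding coeffs_in_def
proof
  fix \<alpha>
  show "keys (lookup (var j * P) \<alpha>) \<subseteq> B"
  proof (cases "\<alpha> \<in> keys (var j * P)")
    case True
    then obtain \<beta> where "\<alpha> = \<beta> + single j 1"
      using keys_mult[of "var j" P] by (auto simp: var_def add.commute)
    then show ?thesis using assms by (simp add: var_def lookup_single_mult coeffs_in_def)
  qed (simp add: in_keys_iff)
qed

lemma coeffs_in_decompose:
  fixes P :: "('j::finite, ('v, 'k::comm_ring_1) mpoly) mpoly"
  assumes "coeffs_in B P"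
  shows "\<exists>e Q. keys e \<subseteq> B \<and> (\<forall>j. coeffs_in B (Q j)) \<and> P = single 0 e + (\<Sum>j\<in>UNIV. var j * Q j)"
proof (induction P rule: poly_mapping_sum_induct)
  case (single \<alpha>)
  have e: "keys (lookup P \<alpha>) \<subseteq> B" using assms by (simp add: coeffs_in_def)
  show ?case
  proof (cases "\<alpha> = 0")
    case True
    then show ?thesis using e by (intro exI[of _ "lookup P \<alpha>"] exI[of _ "\<lambda>_. 0"]) (simp add: coeffs_in_zero)
  next
    case False
    then obtain j where "lookup \<alpha> j > 0" by (metis lookup_zero not_gr_zero poly_mapping_eqI)
    then obtain \<beta> where \<beta>: "\<alpha> = \<beta> + single j 1" by (rule exponent_split_var)
    define Q where "Q i = (if i = j then single \<beta> (lookup P \<alpha>) else 0)" for i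
    have "(\<Sum>i\<in>UNIV. var i * Q i) = single \<alpha> (lookup P \<alpha>)"
      by (simp add: Q_def \<beta> var_def mult_single add.commute if_distrib[of "\<lambda>x. _ * x"] cong: if_cong)
    moreover have "coeffs_in B (Q i)" for i
      using e by (simp add: Q_def coeffs_in_zero coeffs_in_single)
    ultimately show ?thesis by (intro exI[of _ 0] exI[of _ Q]) simp
  qed
next
  case zero
  show ?case by (intro exI[of _ 0] exI[of _ "\<lambda>_. 0"]) (simp add: coeffs_in_zero)
next
  case (add p q)
  then obtain e e' Q Q' where *: "keys e \<subseteq> B" "\<forall>j. coeffs_in B (Q j)" "p = single 0 e + (\<Sum>j\<in>UNIV. var j * Q j)"
    "keys e' \<subseteq> B" "\<forall>j. coeffs_in B (Q' j)" "q = single 0 e' + (\<Sum>j\<in>UNIV. var j * Q' j)"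
    by blast
  have "keys (e + e') \<subseteq> B" using * keys_add[of e e'] by blast
  moreover have "p + q = single 0 (e + e') + (\<Sum>j\<in>UNIV. var j * (Q j + Q' j))"
    by (simp add: * single_add distrib_left sum.distrib)
  ultimately show ?case
    using * by (intro exI[of _ "e + e'"] exI[of _ "\<lambda>j. Q j + Q' j"]) (simp add: coeffs_in_add)
qed

text \<open>A homogeneous system of parameters: as many forms as there are variables, generating an ideal
  that contains a power of the ideal of the variables.\<close>

locale parameter_forms =
  fixes g :: "'v::finite \<Rightarrow> ('v, 'k::field) mpoly" and n M :: nat
  assumes form: "is_form n (g j)" and n_pos: "n > 0"
    and high_mem: "has_order M p \<Longrightarrow> p \<in> ideal_gen (range g)"
begin

text \<open>The set \<open>B\<close> is a maximal set of monomials that is linearly independent modulo the ideal. Its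
  elements may be sought among the finitely many monomials of degree below \<open>M\<close>, because the others
  lie in the ideal.\<close>

lemma exists_complement:
  obtains B where "\<And>p. p \<in> ideal_gen (range g) \<Longrightarrow> keys p \<subseteq> B \<Longrightarrow> p = 0"
    and "\<And>p. \<exists>e. keys e \<subseteq> B \<and> p - e \<in> ideal_gen (range g)"
proof -
  let ?J = "ideal_gen (range g)"
  define S where "S = {B. B \<subseteq> {\<mu>. mdegree \<mu> < M} \<and> (\<forall>p\<in>?J. keys p \<subseteq> B \<longrightarrow> p = 0)}"
  have "finite S" by (rule finite_subset[of _ "Pow {\<mu>. mdegree \<mu> < M}"]) (auto simp: S_def finite_exponents_below)
  moreover have "{} \<in> S" by (simp add: S_def)
  ultimately obtain B where B: "B \<in> S" and max: "\<And>B'. B' \<in> S \<Longrightarrow> B \<subseteq> B' \<Longrightarrow> B = B'"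
    using finite_has_maximal[of S] by blast
  have indep: "p = 0" if "p \<in> ?J" "keys p \<subseteq> B" for p
    using B that by (auto simp: S_def)
  have compl: "\<exists>e. keys e \<subseteq> B \<and> single \<mu> c - e \<in> ?J" for \<mu> and c :: 'k
  proof -
    consider "\<mu> \<in> B" | "M \<le> mdegree \<mu>" | "\<mu> \<notin> B" "mdegree \<mu> < M" by linarith
    then show ?thesis
    proof cases
      case 1
      then show ?thesis by (intro exI[of _ "single \<mu> c"]) (simp add: ideal.span_zero)
    next
      case 2
      then show ?thesis by (intro exI[of _ 0]) (simp add: high_mem has_order_def)
    next
      case 3
      then have "insert \<mu> B \<notin> S" using max[of "insert \<mu> B"] by blast
      then obtain p where p: "p \<in> ?J" "keys p \<subseteq> insert \<mu> B" "p \<noteq> 0"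
        using 3 B by (auto simp: S_def)
      then have a: "lookup p \<mu> \<noteq> 0" using indep[OF p(1)] by (auto simp: in_keys_iff)
      define e where "e = single \<mu> c - mpoly_const (c / lookup p \<mu>) * p"
      have "keys e \<subseteq> B"
      proof
        fix \<nu> assume \<nu>: "\<nu> \<in> keys e"
        have l: "lookup e \<nu> = lookup (single \<mu> c) \<nu> - c / lookup p \<mu> * lookup p \<nu>"
          by (simp add: e_def lookup_minus lookup_mpoly_const_times)
        then have "\<nu> \<noteq> \<mu>" using \<nu> a by (auto simp: in_keys_iff)
        then have "\<nu> \<in> keys p" using \<nu> l by (auto simp: in_keys_iff lookup_single)
        then show "\<nu> \<in> B" using p(2) \<open>\<nu> \<noteq> \<mu>\<close> by blast
      qed
      moreover have "single \<mu> c - e \<in> ?J" by (simp add: e_def ideal.span_scale[OF p(1)])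
      ultimately show ?thesis by blast
    qed
  qed
  have "\<exists>e. keys e \<subseteq> B \<and> p - e \<in> ?J" for p
  proof (induction p rule: poly_mapping_sum_induct)
    case zero
    show ?case by (intro exI[of _ 0]) (simp add: ideal.span_zero)
  next
    case (add q r)
    then obtain d e where *: "keys d \<subseteq> B" "q - d \<in> ?J" "keys e \<subseteq> B" "r - e \<in> ?J" by blast
    have "keys (d + e) \<subseteq> B" using * keys_add[of d e] by blast
    moreover have "q + r - (d + e) \<in> ?J"
      using ideal.span_add[OF *(2,4)] by (simp add: algebra_simps)
    ultimately show ?case by blast
  qed (rule compl)
  with indep show ?thesis by (rule that)
qed

end

locale parameter_forms_complement = parameter_forms g n M
  for g :: "'v::finite \<Rightarrow> ('v, 'k::field) mpoly" and n M +
  fixes B :: "('v \<Rightarrow>\<^sub>0 nat) set"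
  assumes indep: "p \<in> ideal_gen (range g) \<Longrightarrow> keys p \<subseteq> B \<Longrightarrow> p = 0"
    and compl: "\<exists>e. keys e \<subseteq> B \<and> p - e \<in> ideal_gen (range g)"
begin

abbreviation ev :: "('v, ('v, 'k) mpoly) mpoly \<Rightarrow> ('v, 'k) mpoly" where
  "ev \<equiv> eval_mpoly (\<lambda>c. c) g"

lemma ev_var_mult: "ev (var j * P) = g j * ev P"
  by (simp add: id_hom.eval_mult var_def id_hom.eval_single mon_single)

text \<open>Graded Nakayama. Modulo the ideal, \<open>p\<close> equals an element supported on \<open>B\<close>, and the cofactors of
  the difference have degree \<open>m - n < m\<close>.\<close>

lemma spanning_form:
  assumes "is_form m p"
  shows "\<exists>P. coeffs_in B P \<and> ev P = p"
  using assms
proof (induction m arbitrary: p rule: less_induct)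
  case (less m)
  obtain e c where e: "keys e \<subseteq> B" and c: "p - e = (\<Sum>j\<in>UNIV. c j * g j)"
    using compl[of p] by (auto simp: ideal_gen_range)
  let ?e = "deg_part (\<lambda>k. k = m) e" and ?c = "\<lambda>j. deg_part (\<lambda>k. k + n = m) (c j)"
  have "deg_part (\<lambda>k. k = m) (p - e) = (\<Sum>j\<in>UNIV. ?c j * g j)"
    by (simp add: c deg_part_sum deg_part_mult_form[OF form])
  then have p: "p = ?e + (\<Sum>j\<in>UNIV. ?c j * g j)"
    by (simp add: deg_part_diff deg_part_form[OF less.prems] algebra_simps)
  have "\<exists>P. coeffs_in B P \<and> ev P = ?c j" for j
  proof (cases "m = 0")
    case True
    then have "?c j = 0" using n_pos by (intro poly_mapping_eqI) (simp add: lookup_deg_part)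
    then show ?thesis by (intro exI[of _ 0]) (simp add: coeffs_in_zero id_hom.eval_zero)
  next
    case False
    then show ?thesis using n_pos by (intro less.IH[of "m - n"] is_form_deg_part_shift) auto
  qed
  then obtain P where P: "\<And>j. coeffs_in B (P j)" "\<And>j. ev (P j) = ?c j" by metis
  have "ev (single 0 ?e + (\<Sum>j\<in>UNIV. var j * P j)) = p"
    by (subst p) (simp add: id_hom.eval_add id_hom.eval_single id_hom.eval_sum ev_var_mult P mult.commute)
  moreover have "coeffs_in B (single 0 ?e + (\<Sum>j\<in>UNIV. var j * P j))"
    using e P by (intro coeffs_in_add coeffs_in_single coeffs_in_sum coeffs_in_var_mult)
      (auto simp: keys_deg_part)
  ultimately show ?case by blast
qed

lemma spanning: "\<exists>P. coeffs_in B P \<and> ev P = p"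
proof -
  have "\<forall>m. \<exists>P. coeffs_in B P \<and> ev P = deg_part (\<lambda>k. k = m) p"
    using spanning_form[OF is_form_deg_part] by blast
  then obtain P where P: "\<And>m. coeffs_in B (P m)" "\<And>m. ev (P m) = deg_part (\<lambda>k. k = m) p" by metis
  have "coeffs_in B (\<Sum>m\<in>mdegree ` keys p. P m)"
    by (rule coeffs_in_sum) (rule P(1))
  moreover have "ev (\<Sum>m\<in>mdegree ` keys p. P m) = p"
    by (simp only: id_hom.eval_sum P(2) sum_deg_parts[symmetric])
  ultimately show ?thesis by blast
qed

text \<open>The constant coefficient of \<open>P\<close> is supported on \<open>B\<close> and lies in the ideal, so it is zero and
  \<open>P = \<Sum> T\<^sub>j Q\<^sub>j\<close>. The values \<open>Q\<^sub>j(g)\<close> form a syzygy of \<open>g\<close>, which is a Koszul syzygy; subtracting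
  from the \<open>Q\<^sub>j\<close> an antisymmetric combination of the \<open>T\<^sub>k\<close> makes these values zero and does not change
  \<open>\<Sum> T\<^sub>j Q\<^sub>j\<close>.\<close>

lemma kernel_step:
  assumes P: "coeffs_in B P" and ker: "ev P = 0"
  obtains Q where "\<And>j. coeffs_in B (Q j)" "\<And>j. ev (Q j) = 0" "P = (\<Sum>j\<in>UNIV. var j * Q j)"
proof -
  obtain e Q where e: "keys e \<subseteq> B" and Q: "\<And>j. coeffs_in B (Q j)"
    and PQ: "P = single 0 e + (\<Sum>j\<in>UNIV. var j * Q j)"
    using coeffs_in_decompose[OF P] by blast
  have 0: "e + (\<Sum>j\<in>UNIV. ev (Q j) * g j) = 0"
    using ker by (simp add: PQ id_hom.eval_add id_hom.eval_single id_hom.eval_sum ev_var_mult mult.commute)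
  then have "e = - (\<Sum>j\<in>UNIV. ev (Q j) * g j)" by (simp add: eq_neg_iff_add_eq_0)
  moreover have "(\<Sum>j\<in>UNIV. ev (Q j) * g j) \<in> ideal_gen (range g)"
    by (auto simp: ideal_gen_range)
  ultimately have "e = 0" using e ideal.span_neg indep by blast
  have rel: "(\<Sum>j\<in>UNIV. ev (Q j) * g j) = 0" using 0 \<open>e = 0\<close> by simp
  have z: "single (single v M) 1 \<in> ideal_gen (range g)" for v
    by (rule high_mem) (simp add: has_order_def)
  then obtain u where u: "\<And>j. ev (Q j) = (\<Sum>k\<in>UNIV. (u j k - u k j) * g k)"
    using syzygies_koszul[OF z rel] by blast
  have "\<forall>j k. \<exists>P. coeffs_in B P \<and> ev P = u j k" using spanning by blast
  then obtain U where U: "\<And>j k. coeffs_in B (U j k)" "\<And>j k. ev (U j k) = u j k"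
    by metis
  define Q' where "Q' j = Q j - (\<Sum>k\<in>UNIV. var k * (U j k - U k j))" for j
  have Q'1: "coeffs_in B (Q' j)" for j
    unfolding Q'_def by (intro coeffs_in_diff Q coeffs_in_sum coeffs_in_var_mult U)
  have Q'2: "ev (Q' j) = 0" for j
    by (simp add: Q'_def id_hom.eval_diff id_hom.eval_sum ev_var_mult U u mult.commute)
  have "P = (\<Sum>j\<in>UNIV. var j * Q' j)"
  proof -
    have "(\<Sum>j\<in>UNIV. \<Sum>k\<in>UNIV. var j * var k * (U j k - U k j)) = 0"
      by (rule antisymmetric_sum_zero) simp_all
    then show ?thesis
      by (simp add: PQ Q'_def \<open>e = 0\<close> right_diff_distrib sum_subtractf sum_distrib_left mult.assoc)
  qed
  with Q'1 Q'2 show ?thesis by (rule that)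
qed

lemma kernel_has_order:
  assumes "coeffs_in B P" "ev P = 0"
  shows "has_order k P"
  using assms
proof (induction k arbitrary: P)
  case 0
  show ?case by (simp add: has_order_def)
next
  case (Suc k)
  obtain Q where Q: "\<And>j. coeffs_in B (Q j)" "\<And>j. ev (Q j) = 0" and P: "P = (\<Sum>j\<in>UNIV. var j * Q j)"
    by (rule kernel_step[OF Suc.prems]) (rule that)
  have "has_order (1 + k) (var j * Q j)" for j
    by (rule has_order_mult[OF has_order_var Suc.IH[OF Q]])
  then show ?case unfolding P by (intro has_order_sum) simp
qed

lemma independent:
  assumes "coeffs_in B P" "ev P = 0"
  shows "P = 0"
proof -
  have "\<mu> \<notin> keys P" for \<mu>
    using kernel_has_order[OF assms, of "Suc (mdegree \<mu>)"] by (auto simp: has_order_def)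
  then have "keys P = {}" by (simp only: set_eq_iff empty_iff not_False_eq_True simp_thms)
  then show ?thesis by simp
qed

end

section \<open>Parameters are of linear type\<close>

definition koszul_ideal :: "('v \<Rightarrow> 'a::comm_ring_1) \<Rightarrow> ('v, 'a) mpoly set" where
  "koszul_ideal g = ideal_gen {single (single j 1) (g k) - single (single k 1) (g j) |j k. True}"

text \<open>The relation \<open>g\<^sub>j T\<^sub>l \<equiv> g\<^sub>l T\<^sub>j\<close> exchanges indices between the two factors of \<open>g\<^sup>\<alpha> T\<^sup>\<mu>\<close>. If \<open>\<nu>\<close>
  contains \<open>j\<close>, then \<open>\<mu>\<close> can be made to contain \<open>j\<close>, and \<open>T\<^sub>j\<close> is split off from both terms.\<close>

lemma koszul_ideal_mon:
  fixes g :: "'v::finite \<Rightarrow> 'a::comm_ring_1"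
  assumes "\<alpha> + \<mu> = \<beta> + \<nu>" "mdegree \<mu> = mdegree \<nu>"
  shows "single \<mu> (mon g \<alpha>) - single \<nu> (mon g \<beta>) \<in> koszul_ideal g"
  using assms
proof (induction "mdegree \<nu>" arbitrary: \<alpha> \<mu> \<beta> \<nu>)
  case 0
  then have "lookup \<mu> v = 0" "lookup \<nu> v = 0" for v
    using lookup_le_mdegree[of \<mu> v] lookup_le_mdegree[of \<nu> v] by simp_all
  then have "\<mu> = 0" "\<nu> = 0" by (auto intro: poly_mapping_eqI)
  with 0 show ?case by (simp add: koszul_ideal_def ideal.span_zero)
next
  case (Suc i)
  then have "mdegree \<nu> > 0" by simp
  then obtain j where j: "lookup \<nu> j > 0" by (rule mdegree_pos_obtain)
  then obtain \<nu>' where \<nu>: "\<nu> = \<nu>' + single j 1" by (rule exponent_split_var)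
  have step: "single (\<mu>' + single j 1) (mon g \<gamma>) - single \<nu> (mon g \<beta>) \<in> koszul_ideal g"
    if "\<gamma> + (\<mu>' + single j 1) = \<beta> + \<nu>" "mdegree (\<mu>' + single j 1) = mdegree \<nu>" for \<gamma> \<mu>'
  proof -
    have "\<gamma> + \<mu>' + single j 1 = \<beta> + \<nu>' + single j 1" using that(1) by (simp add: \<nu> add.assoc)
    then have "\<gamma> + \<mu>' = \<beta> + \<nu>'" by (rule add_right_imp_eq)
    then have "single \<mu>' (mon g \<gamma>) - single \<nu>' (mon g \<beta>) \<in> koszul_ideal g"
      using that(2) Suc.hyps(2) by (intro Suc.hyps(1)) (simp_all add: \<nu> mdegree_add)
    then have "var j * (single \<mu>' (mon g \<gamma>) - single \<nu>' (mon g \<beta>)) \<in> koszul_ideal g"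
      unfolding koszul_ideal_def by (rule ideal.span_scale)
    then show ?thesis by (simp add: var_def mult_single right_diff_distrib \<nu> add.commute)
  qed
  show ?case
  proof (cases "lookup \<mu> j > 0")
    case True
    then obtain \<mu>' where "\<mu> = \<mu>' + single j 1" by (rule exponent_split_var)
    then show ?thesis using step Suc.prems by simp
  next
    case False
    have "lookup (\<alpha> + \<mu>) j = lookup (\<beta> + \<nu>) j" by (simp only: Suc.prems)
    then have "lookup \<alpha> j > 0" using False j by (simp add: lookup_add)
    then obtain \<alpha>' where \<alpha>: "\<alpha> = \<alpha>' + single j 1" by (rule exponent_split_var)
    have "mdegree \<mu> > 0" using Suc by simp
    then obtain l where "lookup \<mu> l > 0" by (rule mdegree_pos_obtain)
    then obtain \<mu>' where \<mu>: "\<mu> = \<mu>' + single l 1" by (rule exponent_split_var)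
    let ?\<gamma> = "\<alpha>' + single l 1" and ?\<rho> = "\<mu>' + single j 1"
    have "single \<mu>' (mon g \<alpha>') * (single (single l 1) (g j) - single (single j 1) (g l)) \<in> koszul_ideal g"
      unfolding koszul_ideal_def by (intro ideal.span_scale ideal.span_base) blast
    then have "single \<mu> (mon g \<alpha>) - single ?\<rho> (mon g ?\<gamma>) \<in> koszul_ideal g"
      by (simp add: mult_single right_diff_distrib \<mu> \<alpha> mon_add mon_single)
    moreover have "single ?\<rho> (mon g ?\<gamma>) - single \<nu> (mon g \<beta>) \<in> koszul_ideal g"
    proof (rule step)
      show "?\<gamma> + ?\<rho> = \<beta> + \<nu>" using Suc.prems(1) by (simp add: \<alpha> \<mu> ac_simps)
      show "mdegree ?\<rho> = mdegree \<nu>" using Suc.prems(2) by (simp add: \<mu> mdegree_add)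
    qed
    ultimately have "single \<mu> (mon g \<alpha>) - single ?\<rho> (mon g ?\<gamma>) + (single ?\<rho> (mon g ?\<gamma>) - single \<nu> (mon g \<beta>))
        \<in> koszul_ideal g"
      unfolding koszul_ideal_def by (rule ideal.span_add)
    then show ?thesis by simp
  qed
qed

context parameter_forms_complement
begin

text \<open>A chosen representative of the class of the terms \<open>g\<^sup>\<alpha> T\<^sup>\<mu>\<close> with \<open>\<alpha> + \<mu> = \<gamma>\<close> and \<open>\<mu>\<close> of degree
  \<open>i\<close>; it is unspecified if \<open>\<gamma>\<close> has degree less than \<open>i\<close>.\<close>

definition standard_mon :: "nat \<Rightarrow> ('v \<Rightarrow>\<^sub>0 nat) \<Rightarrow> ('v, ('v, 'k) mpoly) mpoly" where
  "standard_mon i \<gamma> = (SOME m. \<exists>\<alpha> \<mu>. \<alpha> + \<mu> = \<gamma> \<and> mdegree \<mu> = i \<and> m = single \<mu> (mon g \<alpha>))"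

lemma standard_mon_cong:
  "single \<mu> (mon g \<alpha>) - standard_mon (mdegree \<mu>) (\<alpha> + \<mu>) \<in> koszul_ideal g"
proof -
  have "\<exists>m \<beta> \<nu>. \<beta> + \<nu> = \<alpha> + \<mu> \<and> mdegree \<nu> = mdegree \<mu> \<and> m = single \<nu> (mon g \<beta>)" by blast
  from someI_ex[OF this, folded standard_mon_def] obtain \<beta> \<nu>
    where "\<beta> + \<nu> = \<alpha> + \<mu>" "mdegree \<nu> = mdegree \<mu>" "standard_mon (mdegree \<mu>) (\<alpha> + \<mu>) = single \<nu> (mon g \<beta>)"
    by blast
  then show ?thesis by (simp add: koszul_ideal_mon)
qed

definition standard_form :: "nat \<Rightarrow> ('v, ('v, 'k) mpoly) mpoly \<Rightarrow> ('v, ('v, 'k) mpoly) mpoly" where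
  "standard_form i P = (\<Sum>\<gamma>\<in>keys P. mpoly_const (lookup P \<gamma>) * standard_mon i \<gamma>)"

lemma standard_form_zero: "standard_form i 0 = 0"
  by (simp add: standard_form_def)

lemma standard_form_single: "standard_form i (single \<gamma> e) = mpoly_const e * standard_mon i \<gamma>"
  by (cases "e = 0") (simp_all add: standard_form_def const_hom.hom_zero)

lemma standard_form_add: "standard_form i (P + Q) = standard_form i P + standard_form i Q"
  unfolding standard_form_def
  by (rule sum_keys_add) (simp_all add: const_hom.hom_zero const_hom.hom_add distrib_right)

text \<open>Expanding the coefficients of \<open>F\<close> as \<open>\<Sum> e\<^sub>\<alpha> g\<^sup>\<alpha>\<close> and replacing each term \<open>e\<^sub>\<alpha> g\<^sup>\<alpha> T\<^sup>\<mu>\<close> by the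
  representative of its class leaves an expression that is determined by \<open>P = \<Sum> e\<^sub>\<alpha> T\<^bsup>\<alpha>+\<mu>\<^esup>\<close>, a polynomial
  with the same value at \<open>g\<close> as \<open>F\<close>. If this value is zero, then so is \<open>P\<close>.\<close>

lemma standard_form_exists:
  assumes "is_form i F"
  shows "\<exists>P. coeffs_in B P \<and> ev P = ev F \<and> F - standard_form i P \<in> koszul_ideal g"
proof -
  let ?S = "\<lambda>F. \<exists>P. coeffs_in B P \<and> ev P = ev F \<and> F - standard_form i P \<in> koszul_ideal g"
  have S_zero: "?S 0"
    by (intro exI[of _ 0]) (simp add: coeffs_in_zero standard_form_zero koszul_ideal_def ideal.span_zero)
  have S_add: "?S (F + G)" if F: "?S F" and G: "?S G" for F G
  proof -
    obtain P Q where *: "coeffs_in B P" "ev P = ev F" "F - standard_form i P \<in> koszul_ideal g"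
      "coeffs_in B Q" "ev Q = ev G" "G - standard_form i Q \<in> koszul_ideal g"
      using F G by blast
    have "F - standard_form i P + (G - standard_form i Q) \<in> koszul_ideal g"
      using *(3,6) unfolding koszul_ideal_def by (rule ideal.span_add)
    then show ?thesis using *
      by (intro exI[of _ "P + Q"]) (simp add: coeffs_in_add id_hom.eval_add standard_form_add algebra_simps)
  qed
  have mono: "?S (single \<mu> (ev Q))" if \<mu>: "mdegree \<mu> = i" and Q: "coeffs_in B Q" for \<mu> Q
  proof (induction Q rule: poly_mapping_sum_induct)
    case (single \<alpha>)
    let ?e = "lookup Q \<alpha>"
    have "mpoly_const ?e * (single \<mu> (mon g \<alpha>) - standard_mon i (\<alpha> + \<mu>)) \<in> koszul_ideal g"
      using standard_mon_cong[of \<mu> \<alpha>] unfolding \<mu> koszul_ideal_def by (rule ideal.span_scale)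
    then have "single \<mu> (ev (single \<alpha> ?e)) - standard_form i (single (\<alpha> + \<mu>) ?e) \<in> koszul_ideal g"
      by (simp add: id_hom.eval_single standard_form_single right_diff_distrib mpoly_const_times_single)
    moreover have "coeffs_in B (single (\<alpha> + \<mu>) ?e)"
      using Q by (intro coeffs_in_single) (simp add: coeffs_in_def)
    ultimately show ?case
      by (intro exI[of _ "single (\<alpha> + \<mu>) ?e"]) (simp add: id_hom.eval_single mon_add mult.assoc)
  next
    case (add q r)
    then show ?case using S_add[of "single \<mu> (ev q)" "single \<mu> (ev r)"] by (simp add: single_add id_hom.eval_add)
  qed (use S_zero in \<open>simp add: id_hom.eval_zero\<close>)
  show ?thesis
  proof (induction F rule: poly_mapping_sum_induct)
    case (single \<mu>)
    obtain Q where "coeffs_in B Q" "ev Q = lookup F \<mu>" using spanning by blast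
    then show ?case using mono[of \<mu> Q] assms single by (auto simp: is_form_def)
  qed (fact S_zero, fact S_add)
qed

lemma linear_type_if_complement:
  assumes "is_form i F" "ev F = 0"
  shows "F \<in> koszul_ideal g"
proof -
  obtain P where P: "coeffs_in B P" "ev P = ev F" "F - standard_form i P \<in> koszul_ideal g"
    using standard_form_exists[OF assms(1)] by blast
  then have "P = 0" using assms(2) by (intro independent) simp_all
  with P(3) show ?thesis by (simp add: standard_form_zero)
qed

end

lemma (in parameter_forms) linear_type:
  assumes "is_form i F" "eval_mpoly (\<lambda>c. c) g F = 0"
  shows "F \<in> koszul_ideal g"
proof -
  obtain B where "\<And>p. p \<in> ideal_gen (range g) \<Longrightarrow> keys p \<subseteq> B \<Longrightarrow> p = 0"
    and "\<And>p. \<exists>e. keys e \<subseteq> B \<and> p - e \<in> ideal_gen (range g)"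
    using exists_complement by blast
  then interpret parameter_forms_complement g n M B
    by unfold_locales
  show ?thesis using assms by (rule linear_type_if_complement)
qed

section \<open>Ideals of finite colength and their reductions\<close>

text \<open>The ideals \<open>I + \<mm>\<^sup>j\<close> form a descending chain, so two of them coincide by finite colength. Since
  \<open>I\<close> is homogeneous, comparing the parts of lowest degree puts all monomials of that degree into
  \<open>I\<close>.\<close>

lemma finite_colength_imp_power_mem:
  fixes I :: "('v::finite, 'a::comm_ring_1) mpoly set"
  assumes I: "is_ideal I" and hom: "\<And>p Q. p \<in> I \<Longrightarrow> deg_part Q p \<in> I" and fin: "finite_colength I"
  obtains m where "\<And>\<mu>. mdegree \<mu> = m \<Longrightarrow> single \<mu> 1 \<in> I"
proof -
  obtain N where N: "\<forall>C. (\<forall>K\<in>C. is_ideal K \<and> I \<subseteq> K) \<and> (\<forall>K\<in>C. \<forall>K'\<in>C. K \<subseteq> K' \<or> K' \<subseteq> K)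
      \<longrightarrow> finite C \<and> card C \<le> N + 1"
    using fin unfolding finite_colength_def ..
  define K where "K j = {u + h |u h. u \<in> I \<and> h \<in> {p. has_order j p}}" for j
  have K_ideal: "is_ideal (K j)" for j
  proof -
    have "ideal_gen I = I" using I by simp
    moreover have "ideal_gen {p :: ('v, 'a) mpoly. has_order j p} = {p. has_order j p}"
      unfolding ideal.span_eq_iff by (rule is_ideal_has_order)
    ultimately have "K j = ideal_gen (I \<union> {p. has_order j p})"
      by (simp only: K_def ideal.span_Un)
    then show ?thesis by simp
  qed
  have K_sup: "I \<subseteq> K j" for j
  proof
    fix u assume "u \<in> I"
    then show "u \<in> K j" unfolding K_def by (intro CollectI exI[of _ u] exI[of _ 0]) simp
  qed
  have K_anti: "K j \<subseteq> K i" if "i \<le> j" for i j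
  proof -
    have "{p :: ('v, 'a) mpoly. has_order j p} \<subseteq> {p. has_order i p}"
      using that by (auto simp: has_order_def intro: order_trans)
    then show ?thesis unfolding K_def by blast
  qed
  have "card (K ` {..N + 1}) \<le> N + 1"
  proof (rule conjunct2[OF mp[OF spec[OF N]]], rule conjI)
    show "\<forall>A\<in>K ` {..N + 1}. is_ideal A \<and> I \<subseteq> A" using K_ideal K_sup by blast
    show "\<forall>A\<in>K ` {..N + 1}. \<forall>B\<in>K ` {..N + 1}. A \<subseteq> B \<or> B \<subseteq> A"
    proof -
      have "K i \<subseteq> K j \<or> K j \<subseteq> K i" for i j
        using K_anti[of i j] K_anti[of j i] nat_le_linear[of i j] by argo
      then show ?thesis by (simp only: ball_simps) simp
    qed
  qed
  then have "\<not> inj_on K {..N + 1}" by (auto dest: card_image)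
  then obtain i j where "i \<noteq> j" "K i = K j" by (auto simp: inj_on_def)
  then obtain i j where ij: "i < j" "K i = K j" by (metis nat_neq_iff)
  have "single \<mu> 1 \<in> I" if \<mu>: "mdegree \<mu> = i" for \<mu>
  proof -
    have "single \<mu> 1 \<in> K i" unfolding K_def
      using \<mu> ideal.subspace_0[OF I] by (intro CollectI exI[of _ 0] exI[of _ "single \<mu> 1"]) (simp add: has_order_def)
    then obtain u h where uh: "single \<mu> 1 = u + h" "u \<in> I" "has_order j h"
      unfolding ij(2) by (auto simp: K_def)
    have "keys (deg_part (\<lambda>k. k = i) h) = {}"
      using uh(3) ij(1) by (auto simp: keys_deg_part has_order_def)
    then have "single \<mu> 1 = deg_part (\<lambda>k. k = i) u"
      using arg_cong[OF uh(1), of "deg_part (\<lambda>k. k = i)"] \<mu> by (simp add: deg_part_add deg_part_single)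
    then show ?thesis using hom[OF uh(2)] by simp
  qed
  then show ?thesis by (rule that)
qed

text \<open>If \<open>\<mm>\<^sup>m \<subseteq> I\<close>, then \<open>\<mm>\<^bsup>m(q+1)\<^esup> \<subseteq> I\<^bsup>q+1\<^esup> = J I\<^sup>q \<subseteq> J\<close>.\<close>

lemma reduction_power_mem:
  fixes I J :: "('v::finite, 'a::comm_ring_1) mpoly set"
  assumes "is_reduction J I" and I: "\<And>\<mu>. mdegree \<mu> = m \<Longrightarrow> single \<mu> 1 \<in> I"
  obtains M where "\<And>p. has_order M p \<Longrightarrow> p \<in> J"
proof -
  obtain q where J: "is_ideal J" and q: "ideal_pow I (q + 1) = ideal_mult J (ideal_pow I q)"
    using assms(1) by (auto simp: is_reduction_def)
  have "ideal_mult J (ideal_pow I q) \<subseteq> J"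
  proof (rule ideal_mult_subset[OF J])
    show "a * b \<in> J" if "a \<in> J" for a b
      using ideal.subspace_scale[OF J that, of b] by (simp add: mult.commute)
  qed
  then have "p \<in> J" if "has_order (m * (q + 1)) p" for p
    using has_order_imp_ideal_pow[OF I that] q by blast
  then show ?thesis by (rule that)
qed

text \<open>Forms of degree zero are constants. Among constants, a single nonzero one generates everything,
  and none is required if all are zero, whereas there are at least two generators.\<close>

lemma minimally_generates_degree_pos:
  fixes f :: "'j::finite option \<Rightarrow> ('v::finite, 'k::field) mpoly"
  assumes min: "minimally_generates f I" and form: "\<And>j. is_form n (f j)"
  shows "n > 0"
proof (rule ccontr)
  assume "\<not> n > 0"
  then have deg: "mdegree \<mu> = 0" if "\<mu> \<in> keys (f j)" for j \<mu>
    using form that by (auto simp: is_form_def)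
  have const: "f j = mpoly_const (lookup (f j) 0)" for j
  proof (rule poly_mapping_eqI)
    fix \<mu>
    have "\<mu> = 0" if "\<mu> \<in> keys (f j)"
      using deg[OF that] lookup_le_mdegree[of \<mu>] by (intro poly_mapping_eqI) simp
    then show "lookup (f j) \<mu> = lookup (mpoly_const (lookup (f j) 0)) \<mu>"
      by (cases "\<mu> = 0") (auto simp: mpoly_const_def lookup_single in_keys_iff)
  qed
  obtain A :: "'j option set" where A: "A \<subset> UNIV" and gen: "\<And>j. f j \<in> ideal_gen (f ` A)"
  proof (cases "\<exists>j. f j \<noteq> 0")
    case False
    then show ?thesis by (intro that[of "{}"]) auto
  next
    case True
    then obtain j where j: "f j \<noteq> 0" by blast
    then have c: "lookup (f j) 0 \<noteq> 0" by (metis const const_hom.hom_zero)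
    have "f i \<in> ideal_gen (f ` {j})" for i
    proof -
      have "mpoly_const (lookup (f i) 0 / lookup (f j) 0) * f j = f i"
        by (subst (2) const, subst (2) const) (simp add: c flip: const_hom.hom_mult)
      moreover have "mpoly_const (lookup (f i) 0 / lookup (f j) 0) * f j \<in> ideal_gen (f ` {j})"
        by (intro ideal.span_scale ideal.span_base) simp
      ultimately show ?thesis by simp
    qed
    moreover have "{j} \<noteq> UNIV" by (metis UNIV_I option.distinct(1) singletonD)
    then have "{j} \<subset> UNIV" by blast
    ultimately show ?thesis by (intro that[of "{j}"])
  qed
  have "ideal_gen (range f) \<subseteq> ideal_gen (f ` A)"
    using gen by (intro ideal.span_minimal) auto
  moreover have "ideal_gen (f ` A) \<subseteq> ideal_gen (range f)" by (rule ideal.span_mono) auto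
  ultimately show False using min A unfolding minimally_generates_def by blast
qed

text \<open>No form of degree above the socle degree is outside \<open>J : a\<close>. The power of \<open>\<mm>\<close> contained in \<open>J\<close>
  bounds the degrees of the forms outside \<open>J : a\<close>, without which their maximum would be
  unspecified.\<close>

lemma has_order_imp_mem_colon:
  fixes J :: "('v::finite, 'a::comm_ring_1) mpoly set"
  assumes J: "is_ideal J" and M: "\<And>p. has_order M p \<Longrightarrow> p \<in> J"
    and c: "has_order (socle_degree (colon J {a}) + 1) c"
  shows "c * a \<in> J"
proof -
  let ?S = "\<lambda>m. \<exists>p. is_form m p \<and> p \<notin> colon J {a}"
  have bound: "m \<le> M" if "?S m" for m
  proof (rule ccontr)
    assume m: "\<not> m \<le> M"
    obtain p where p: "is_form m p" "p \<notin> colon J {a}" using \<open>?S m\<close> by blast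
    have "has_order M p" using p(1) m by (simp add: has_order_def is_form_def)
    then have "a * p \<in> J" by (intro ideal.subspace_scale[OF J] M)
    then show False using p(2) by (simp add: colon_def mult.commute)
  qed
  have "deg_part (\<lambda>k. k = m) c * a \<in> J" if "m \<in> mdegree ` keys c" for m
  proof (rule ccontr)
    assume "deg_part (\<lambda>k. k = m) c * a \<notin> J"
    then have "?S m" by (intro exI[of _ "deg_part (\<lambda>k. k = m) c"]) (simp add: is_form_deg_part colon_def)
    then have "m \<le> socle_degree (colon J {a})"
      unfolding socle_degree_def using bound by (intro Greatest_le_nat)
    then show False using that c by (auto simp: has_order_def)
  qed
  then have "(\<Sum>m\<in>mdegree ` keys c. deg_part (\<lambda>k. k = m) c * a) \<in> J"
    by (rule ideal.subspace_sum[OF J])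
  then show ?thesis by (simp only: sum_distrib_right[symmetric] sum_deg_parts[symmetric])
qed

section \<open>The Rees kernel\<close>

lemma mon_var:
  fixes \<mu> :: "'j::finite \<Rightarrow>\<^sub>0 nat"
  shows "mon var \<mu> = (single \<mu> 1 :: ('j, 'a::comm_ring_1) mpoly)"
proof -
  have pow: "var j ^ m = (single (single j m) 1 :: ('j, 'a) mpoly)" for m and j :: 'j
    by (induction m) (simp_all add: var_def mult_single flip: single_add)
  have "(\<Prod>j\<in>A. var j ^ lookup \<mu> j) = (single (\<Sum>j\<in>A. single j (lookup \<mu> j)) 1 :: ('j, 'a) mpoly)" for A
    by (induction A rule: infinite_finite_induct) (simp_all add: pow mult_single)
  moreover have "(\<Sum>j\<in>UNIV. single j (lookup \<mu> j)) = \<mu>"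
    by (intro poly_mapping_eqI) (simp add: lookup_sum lookup_single when_def)
  ultimately show ?thesis by (simp add: mon_def)
qed

lemma rees_map_eval: "rees_map f = eval_mpoly (\<lambda>c. [:c:]) (\<lambda>j. monom (f j) 1)"
  by (simp add: rees_map_def eval_mpoly_def mon_def fun_eq_iff)

lemma mon_monom: "mon (\<lambda>j. monom (f j) 1) \<mu> = monom (mon f \<mu>) (mdegree \<mu>)"
proof -
  have "(\<Prod>j\<in>A. monom (f j) 1 ^ lookup \<mu> j) = monom (\<Prod>j\<in>A. f j ^ lookup \<mu> j) (\<Sum>j\<in>A. lookup \<mu> j)" for A
    by (induction A rule: infinite_finite_induct) (simp_all add: monom_power mult_monom)
  then show ?thesis by (simp add: mon_def mdegree_def)
qed

lemma coeff_rees_map: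
  "coeff (rees_map f F) i = eval_mpoly (\<lambda>c. c) f (deg_part (\<lambda>k. k = i) F)"
  unfolding rees_map_eval
proof (induction F rule: poly_mapping_sum_induct)
  case (single \<mu>)
  show ?case
    by (auto simp: poly_const_hom.eval_single mon_monom deg_part_single id_hom.eval_single
        id_hom.eval_zero smult_monom simp del: One_nat_def)
qed (simp_all add: poly_const_hom.eval_zero poly_const_hom.eval_add id_hom.eval_zero id_hom.eval_add deg_part_add)

lemma rees_kernel_iff:
  "F \<in> rees_kernel f \<longleftrightarrow> (\<forall>i. eval_mpoly (\<lambda>c. c) f (deg_part (\<lambda>k. k = i) F) = 0)"
  by (simp add: rees_kernel_def poly_eq_iff coeff_rees_map)

lemma rees_kernel_deg_iff:
  "F \<in> rees_kernel_deg f i \<longleftrightarrow> is_form i F \<and> eval_mpoly (\<lambda>c. c) f F = 0"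
proof -
  have "(\<forall>j. eval_mpoly (\<lambda>c. c) f (deg_part (\<lambda>k. k = j) F) = 0) \<longleftrightarrow> eval_mpoly (\<lambda>c. c) f F = 0"
    if "is_form i F"
  proof -
    have "deg_part (\<lambda>k. k = j) F = (if j = i then F else 0)" for j
      using that by (intro poly_mapping_eqI) (auto simp: lookup_deg_part is_form_def in_keys_iff)
    then show ?thesis by (metis id_hom.eval_zero)
  qed
  then show ?thesis by (auto simp: rees_kernel_deg_def rees_kernel_iff)
qed

lemma is_ideal_rees_kernel: "is_ideal (rees_kernel f)"
proof -
  interpret ring_hom_fun "rees_map f"
    unfolding rees_map_eval by (rule poly_const_hom.ring_hom_eval)
  show ?thesis using is_ideal_vimage[of "{0}"] by (simp add: rees_kernel_def)
qed

lemma linear_relations_subset_kernel: "ideal_gen (rees_kernel_deg f 1) \<subseteq> rees_kernel f"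
  by (rule ideal.span_minimal[OF _ is_ideal_rees_kernel]) (auto simp: rees_kernel_deg_def)

lemma linear_relations_eval:
  assumes "F \<in> ideal_gen (rees_kernel_deg f 1)"
  shows "eval_mpoly (\<lambda>c. c) f F = 0"
proof -
  interpret ring_hom_fun "eval_mpoly (\<lambda>c. c) f" by (rule id_hom.ring_hom_eval)
  have "ideal_gen (rees_kernel_deg f 1) \<subseteq> {F. eval_mpoly (\<lambda>c. c) f F \<in> {0}}"
    by (intro ideal.span_minimal is_ideal_vimage) (auto simp: rees_kernel_deg_iff)
  then show ?thesis using assms by auto
qed

section \<open>Eliminating the last variable\<close>

definition embed_vars :: "('j::finite, 'a::comm_ring_1) mpoly \<Rightarrow> ('j option, 'a) mpoly" where
  "embed_vars = eval_mpoly mpoly_const (\<lambda>j. var (Some j))"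

interpretation embed: ring_hom_fun embed_vars
  unfolding embed_vars_def by (rule const_hom.ring_hom_eval)

lemma embed_vars_single: "embed_vars (single \<mu> c) = mpoly_const c * mon (\<lambda>j. var (Some j)) \<mu>"
  by (simp add: embed_vars_def const_hom.eval_single)

lemma eval_embed_vars:
  "eval_mpoly (\<lambda>c. c) f (embed_vars F) = eval_mpoly (\<lambda>c. c) (\<lambda>j. f (Some j)) F"
proof -
  interpret ev: ring_hom_fun "eval_mpoly (\<lambda>c. c) f" by (rule id_hom.ring_hom_eval)
  show ?thesis
  proof (induction F rule: poly_mapping_sum_induct)
    case (single \<mu>)
    have "eval_mpoly (\<lambda>c. c) f (var (Some j)) = f (Some j)" for j
      by (simp add: var_def id_hom.eval_single mon_single)
    then show ?case
      by (simp add: embed_vars_single ev.hom_mult ev.hom_mon id_hom.eval_single)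
        (simp add: mpoly_const_def id_hom.eval_single)
  qed (simp_all add: embed.hom_zero ev.hom_zero embed.hom_add ev.hom_add id_hom.eval_zero id_hom.eval_add)
qed

lemma mdegree_option:
  "mdegree \<mu> = lookup \<mu> None + (\<Sum>j\<in>UNIV. lookup \<mu> (Some j))"
  by (simp add: mdegree_def UNIV_option_conv sum.reindex)

text \<open>The image of \<open>embed_vars\<close> consists of the polynomials free of \<open>T\<^bsub>d+1\<^esub>\<close>.\<close>

lemma single_eq_embed_vars:
  assumes "lookup \<mu> None = 0"
  obtains \<mu>' where "mdegree \<mu>' = mdegree \<mu>" "single \<mu> c = embed_vars (single \<mu>' c)"
proof
  let ?\<mu> = "Poly_Mapping.map_key Some \<mu>"
  have l: "lookup ?\<mu> j = lookup \<mu> (Some j)" for j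
    by (simp add: map_key.rep_eq)
  show "mdegree ?\<mu> = mdegree \<mu>"
    using assms by (simp add: mdegree_option) (simp add: mdegree_def l)
  have "(mon var \<mu> :: ('a option, 'b) mpoly) = mon (\<lambda>j. var (Some j)) ?\<mu>"
    by (simp add: mon_def UNIV_option_conv prod.reindex assms l)
  moreover have "single \<mu> c = mpoly_const c * mon var \<mu>"
    by (simp add: mon_var mpoly_const_times_single)
  ultimately show "single \<mu> c = embed_vars (single ?\<mu> c)"
    by (simp add: embed_vars_single)
qed

lemma embed_koszul_ideal:
  fixes f :: "'j::finite option \<Rightarrow> 'a::comm_ring_1" and F :: "('j, 'a) mpoly"
  assumes "F \<in> koszul_ideal (\<lambda>j. f (Some j))"
  shows "embed_vars F \<in> ideal_gen (rees_kernel_deg f 1)"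
proof -
  have "koszul_ideal (\<lambda>j. f (Some j)) \<subseteq> {F. embed_vars F \<in> ideal_gen (rees_kernel_deg f 1)}"
    unfolding koszul_ideal_def
  proof (intro ideal.span_minimal embed.is_ideal_vimage ideal.subspace_span subsetI CollectI)
    fix F :: "('j, 'a) mpoly"
    assume "F \<in> {single (single j 1) (f (Some k)) - single (single k 1) (f (Some j)) |j k. True}"
    then obtain j k where F: "F = single (single j 1) (f (Some k)) - single (single k 1) (f (Some j))"
      by blast
    have emb: "embed_vars (single (single i 1) c) = single (single (Some i) 1) c" for i and c :: 'a
      by (simp add: embed_vars_single mon_single) (simp add: var_def mpoly_const_times_single)
    have "embed_vars F + embed_vars (single (single k 1) (f (Some j))) = embed_vars (single (single j 1) (f (Some k)))"
      unfolding F by (simp flip: embed.hom_add)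
    then have "embed_vars F = single (single (Some j) 1) (f (Some k)) - single (single (Some k) 1) (f (Some j))"
      unfolding emb by (simp add: eq_diff_eq)
    moreover have "single (single (Some j) 1) (f (Some k)) - single (single (Some k) 1) (f (Some j)) \<in> rees_kernel_deg f 1"
      unfolding rees_kernel_deg_iff
    proof
      show "is_form 1 (single (single (Some j) 1) (f (Some k)) - single (single (Some k) 1) (f (Some j)))"
        unfolding is_form_def
      proof
        fix \<mu> :: "'j option \<Rightarrow>\<^sub>0 nat"
        assume "\<mu> \<in> keys (single (single (Some j) 1) (f (Some k)) - single (single (Some k) 1) (f (Some j)))"
        then have "\<mu> = single (Some j) 1 \<or> \<mu> = single (Some k) 1"
          using keys_diff by (fastforce split: if_splits)
        then show "mdegree \<mu> = 1" by auto
      qed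
    qed (simp add: id_hom.eval_diff id_hom.eval_single mon_single mult.commute)
    ultimately show "embed_vars F \<in> ideal_gen (rees_kernel_deg f 1)"
      by (simp add: ideal.span_base)
  qed
  then show ?thesis using assms by blast
qed

text \<open>Parts of the cofactors of degree below \<open>r\<close> contribute only to degrees below \<open>r + n\<close>, where
  \<open>c a\<close> has no terms, so they can be dropped. This uses that \<open>a\<close> and the \<open>g\<^sub>j\<close> have the same degree.\<close>

lemma high_order_syzygy:
  fixes g :: "'j::finite \<Rightarrow> ('v::finite, 'a::comm_ring_1) mpoly"
  assumes g: "\<And>j. is_form n (g j)" and a: "is_form n a"
    and c: "has_order r c" "c * a \<in> ideal_gen (range g)"
  obtains b where "\<And>j. has_order r (b j)" "c * a = (\<Sum>j\<in>UNIV. b j * g j)"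
proof -
  obtain b where b: "c * a = (\<Sum>j\<in>UNIV. b j * g j)" using c(2) by (auto simp: ideal_gen_range)
  let ?Q = "\<lambda>m. r + n \<le> m"
  have "deg_part ?Q (c * a) = (\<Sum>j\<in>UNIV. deg_part (\<lambda>m. r \<le> m) (b j) * g j)"
    unfolding b by (simp add: deg_part_sum deg_part_mult_form[OF g])
  moreover have "deg_part ?Q (c * a) = c * a"
    using c(1) by (simp add: deg_part_mult_form[OF a] deg_part_eq_self has_order_def)
  ultimately show ?thesis
    by (intro that[of "\<lambda>j. deg_part (\<lambda>m. r \<le> m) (b j)"]) (simp_all add: has_order_def keys_deg_part)
qed

text \<open>One factor \<open>T\<^bsub>d+1\<^esub>\<close> is traded for \<open>T\<^sub>1, \<dots>, T\<^sub>d\<close> by the linear relation of a syzygy whose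
  coefficients are again in \<open>\<mm>\<^sup>r\<close>, so that the step can be repeated.\<close>

lemma eliminate_None_single:
  fixes f :: "'v::finite option \<Rightarrow> ('v, 'k::comm_ring_1) mpoly"
  assumes form: "\<And>j. is_form n (f j)"
    and colon: "\<And>c. has_order r c \<Longrightarrow> c * f None \<in> ideal_gen (range (\<lambda>j. f (Some j)))"
    and c: "has_order r c"
  shows "\<exists>F. is_form (mdegree \<mu>) F \<and> single \<mu> c - embed_vars F \<in> ideal_gen (rees_kernel_deg f 1)"
  using c
proof (induction "lookup \<mu> None" arbitrary: \<mu> c)
  case 0
  then obtain \<mu>' where "mdegree \<mu>' = mdegree \<mu>" "single \<mu> c = embed_vars (single \<mu>' c)"
    using single_eq_embed_vars[of \<mu>] by metis
  then show ?case by (intro exI[of _ "single \<mu>' c"]) (simp add: is_form_single ideal.span_zero)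
next
  case (Suc t)
  let ?L = "ideal_gen (rees_kernel_deg f 1)"
  have "lookup \<mu> None > 0" using Suc.hyps(2) by simp
  then obtain \<nu> where \<mu>: "\<mu> = \<nu> + single None 1" by (rule exponent_split_var)
  obtain b where b: "\<And>j. has_order r (b j)" and rel: "c * f None = (\<Sum>j\<in>UNIV. b j * f (Some j))"
    using high_order_syzygy[OF form form Suc.prems colon[OF Suc.prems]] by metis
  let ?\<mu> = "\<lambda>j. \<nu> + single (Some j) 1"
  have "\<exists>F. is_form (mdegree (?\<mu> j)) F \<and> single (?\<mu> j) (b j) - embed_vars F \<in> ?L" for j
    using Suc.hyps(2) b by (intro Suc.hyps(1)) (simp_all add: \<mu> lookup_add lookup_single)
  then obtain F where F: "\<And>j. is_form (mdegree (?\<mu> j)) (F j)"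
      "\<And>j. single (?\<mu> j) (b j) - embed_vars (F j) \<in> ?L" by metis
  (* The linear relation of the syzygy c a = sum of b_j g_j; its multiple by the remaining
     monomial rewrites the given term. *)
  define l :: "('v option, ('v, 'k) mpoly) mpoly" where "l = single (single None 1) c - (\<Sum>j\<in>UNIV. single (single (Some j) 1) (b j))"
  have "l \<in> rees_kernel_deg f 1"
    unfolding rees_kernel_deg_iff l_def
    by (intro conjI is_form_diff is_form_sum is_form_single)
      (simp_all add: id_hom.eval_diff id_hom.eval_sum id_hom.eval_single mon_single rel)
  then have 1: "single \<nu> 1 * l \<in> ?L" by (intro ideal.span_scale ideal.span_base)
  have 2: "(\<Sum>j\<in>UNIV. single (?\<mu> j) (b j) - embed_vars (F j)) \<in> ?L"
    by (intro ideal.span_sum F)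
  have "embed_vars (\<Sum>j\<in>UNIV. F j) = (\<Sum>j\<in>UNIV. embed_vars (F j))"
    by (simp add: embed_vars_def const_hom.eval_sum)
  then have "single \<nu> 1 * l + (\<Sum>j\<in>UNIV. single (?\<mu> j) (b j) - embed_vars (F j))
      = single \<mu> c - embed_vars (\<Sum>j\<in>UNIV. F j)"
    by (simp add: l_def \<mu> right_diff_distrib mult_single sum_distrib_left sum_subtractf)
  then have "single \<mu> c - embed_vars (\<Sum>j\<in>UNIV. F j) \<in> ?L"
    using ideal.span_add[OF 1 2] by simp
  moreover have "is_form (mdegree \<mu>) (\<Sum>j\<in>UNIV. F j)"
    using F(1) by (intro is_form_sum) (simp add: \<mu> mdegree_add)
  ultimately show ?case by blast
qed

lemma eliminate_None:
  fixes f :: "'v::finite option \<Rightarrow> ('v, 'k::comm_ring_1) mpoly"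
  assumes form: "\<And>j. is_form n (f j)"
    and colon: "\<And>c. has_order r c \<Longrightarrow> c * f None \<in> ideal_gen (range (\<lambda>j. f (Some j)))"
    and F: "is_form i F" "\<And>\<mu>. has_order r (lookup F \<mu>)"
  shows "\<exists>G. is_form i G \<and> F - embed_vars G \<in> ideal_gen (rees_kernel_deg f 1)"
proof (induction F rule: poly_mapping_sum_induct)
  case (single \<mu>)
  then have "mdegree \<mu> = i" using F(1) by (simp add: is_form_def)
  then show ?case using eliminate_None_single[OF form colon F(2), of \<mu> \<mu>] by blast
next
  case zero
  show ?case by (intro exI[of _ 0]) (simp add: is_form_zero embed.hom_zero ideal.span_zero)
next
  case (add p q)
  then obtain G H where *: "is_form i G" "p - embed_vars G \<in> ideal_gen (rees_kernel_deg f 1)"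
    "is_form i H" "q - embed_vars H \<in> ideal_gen (rees_kernel_deg f 1)" by blast
  then have "p + q - embed_vars (G + H) \<in> ideal_gen (rees_kernel_deg f 1)"
    using ideal.span_add[OF *(2,4)] by (simp add: embed.hom_add algebra_simps)
  with * show ?case by (intro exI[of _ "G + H"]) (simp add: is_form_add)
qed

lemma high_order_relations_linear:
  fixes f :: "'v::finite option \<Rightarrow> ('v, 'k::field) mpoly"
  assumes params: "parameter_forms (\<lambda>j. f (Some j)) n M" and None: "is_form n (f None)"
    and colon: "\<And>c. has_order r c \<Longrightarrow> c * f None \<in> ideal_gen (range (\<lambda>j. f (Some j)))"
    and F: "F \<in> rees_kernel_deg f i" "\<And>\<mu>. has_order r (lookup F \<mu>)"
  shows "F \<in> ideal_gen (rees_kernel_deg f 1)"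
proof -
  interpret parameter_forms "\<lambda>j. f (Some j)" n M by (rule params)
  have "is_form n (f j)" for j using form None by (cases j) auto
  then obtain G where G: "is_form i G" "F - embed_vars G \<in> ideal_gen (rees_kernel_deg f 1)"
    using eliminate_None[of n f r i F] colon F by (auto simp: rees_kernel_deg_iff)
  have "eval_mpoly (\<lambda>c. c) (\<lambda>j. f (Some j)) G = 0"
    using linear_relations_eval[OF G(2)] F(1)
    by (simp add: id_hom.eval_diff eval_embed_vars rees_kernel_deg_iff)
  then have "embed_vars G \<in> ideal_gen (rees_kernel_deg f 1)"
    by (intro embed_koszul_ideal linear_type[OF G(1)])
  then show ?thesis using ideal.span_add[OF G(2)] by fastforce
qed

theorem theorem2p6:
  fixes f :: "'d::finite option \<Rightarrow> ('d, 'k::field) mpoly"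
    and a :: "('d, 'k) mpoly"
    and I J :: "('d, 'k) mpoly set"
    and n \<epsilon> r :: nat
  assumes "CARD('d) \<ge> 2"
    and "minimally_generates f I"
    and "\<And>j. is_form n (f j)"
    and "finite_colength I"
    and "J = ideal_gen (range (\<lambda>j. f (Some j)))"
    and "is_minimal_reduction J I"
    and "a = f None"
    and "\<epsilon> = socle_degree (colon J {a})"
    and "r = \<epsilon> + 1"
  shows "rees_kernel f
           = colon (ideal_gen (rees_kernel_deg f 1)) (mpoly_const ` ideal_pow max_ideal r)
       \<and> (\<forall>i. \<forall>F \<in> rees_kernel_deg f i.
            (\<forall>\<mu>. Poly_Mapping.lookup F \<mu> \<in> ideal_pow max_ideal r) \<longrightarrow> F \<in> ideal_gen (rees_kernel_deg f 1))"
proof -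
  let ?L = "ideal_gen (rees_kernel_deg f 1)"
  have I: "I = ideal_gen (range f)" using assms(2) by (simp add: minimally_generates_def)
  have "is_ideal I" by (simp add: I)
  moreover have "deg_part Q p \<in> I" if "p \<in> I" for p Q
    using that deg_part_ideal_gen_forms[OF assms(3)] by (simp add: I)
  ultimately obtain m where "\<And>\<mu>. mdegree \<mu> = m \<Longrightarrow> single \<mu> 1 \<in> I"
    using finite_colength_imp_power_mem[of I] assms(4) by blast
  then obtain M where M: "\<And>p. has_order M p \<Longrightarrow> p \<in> J"
    using reduction_power_mem[of J I m] assms(6) unfolding is_minimal_reduction_def by blast
  have params: "parameter_forms (\<lambda>j. f (Some j)) n M"
    using M assms(3,5) minimally_generates_degree_pos[OF assms(2,3)] by unfold_locales auto
  have "is_ideal J" by (simp add: assms(5))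
  then have colon: "c * f None \<in> ideal_gen (range (\<lambda>j. f (Some j)))" if "has_order r c" for c
    using has_order_imp_mem_colon[of J M a c] M that by (simp add: assms(5,7,8,9))
  have linear: "F \<in> ?L" if "F \<in> rees_kernel_deg f i" "\<And>\<mu>. has_order r (lookup F \<mu>)" for i F
  proof (rule high_order_relations_linear[OF params assms(3) _ that(1)])
    show "c * f None \<in> ideal_gen (range (\<lambda>j. f (Some j)))" if "has_order r c" for c
      using that by (rule colon)
    show "has_order r (lookup F \<mu>)" for \<mu> by (rule that(2))
  qed
  have "rees_kernel f \<subseteq> colon ?L (mpoly_const ` ideal_pow max_ideal r)"
  proof
    fix F assume F: "F \<in> rees_kernel f"
    have "F * mpoly_const c \<in> ?L" if c: "has_order r c" for c
    proof -
      let ?F = "\<lambda>i. deg_part (\<lambda>k. k = i) F"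
      have "mpoly_const c * ?F i \<in> ?L" for i
      proof (rule linear)
        show "mpoly_const c * ?F i \<in> rees_kernel_deg f i"
          unfolding rees_kernel_deg_iff
        proof
          show "is_form i (mpoly_const c * ?F i)"
            by (auto simp: is_form_def in_keys_iff lookup_mpoly_const_times lookup_deg_part split: if_splits)
          show "eval_mpoly (\<lambda>c. c) f (mpoly_const c * ?F i) = 0"
            using F by (simp add: id_hom.eval_mult rees_kernel_iff)
        qed
        show "has_order r (lookup (mpoly_const c * ?F i) \<mu>)" for \<mu>
          using has_order_mult[OF c, of 0 "lookup (?F i) \<mu>"]
          by (simp add: lookup_mpoly_const_times has_order_def)
      qed
      then have "(\<Sum>i\<in>mdegree ` keys F. mpoly_const c * ?F i) \<in> ?L" by (rule ideal.span_sum)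
      then show ?thesis
        by (simp only: sum_distrib_left[symmetric] sum_deg_parts[symmetric] mult.commute)
    qed
    then show "F \<in> colon ?L (mpoly_const ` ideal_pow max_ideal r)"
      by (auto simp: colon_def ideal_pow_max_ideal)
  qed
  moreover have "colon ?L (mpoly_const ` ideal_pow max_ideal r) \<subseteq> rees_kernel f"
  proof
    fix F assume F: "F \<in> colon ?L (mpoly_const ` ideal_pow max_ideal r)"
    (* Any variable will do: a power of it lies in the r-th power of the maximal ideal and is not
       a zero divisor. *)
    let ?z = "single (single undefined r) 1 :: ('d, 'k) mpoly"
    have "?z \<in> ideal_pow max_ideal r" by (simp add: ideal_pow_max_ideal has_order_def)
    then have "F * mpoly_const ?z \<in> rees_kernel f"
      using F linear_relations_subset_kernel unfolding colon_def by blast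
    then have "rees_map f F * [:?z:] = 0"
      by (simp add: rees_kernel_def rees_map_eval poly_const_hom.eval_mult)
        (simp add: mpoly_const_def poly_const_hom.eval_single)
    then have "?z * coeff (rees_map f F) i = 0" for i
      by (simp add: mult.commute[of _ "[:_:]"] poly_eq_iff)
    then show "F \<in> rees_kernel f"
      using single_mult_eq_0D by (simp add: rees_kernel_def poly_eq_iff) blast
  qed
  ultimately show ?thesis using linear by (auto simp: ideal_pow_max_ideal)
qed

end
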